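(* Consider the ISA model $\mathbf{z}=\mathbf{A}\mathbf{s}$ with independent $d$-dimensional sources $\mathbf{s}^1,\ldots,\mathbf{s}^M$, $\mathbf{s}=[\mathbf{s}^1;\ldots;\mathbf{s}^M]\in\mathbb{R}^D$, $D=dM$. Assume that every source $\mathbf{s}^m=(s^m_1,\ldots,s^m_d)$, $m=1,\ldots,M$, satisfies $$H\left(\sum_{i=1}^d w_i s^m_i\right)\ \ge\ \sum_{i=1}^d w_i^2\,H(s^m_i)\qquad\text{for all }\mathbf{w}\in S^d ,$$ and that the ICA cost function $J_{\mathrm{ICA}}(\mathbf{W})=\sum_{m=1}^M\sum_{i=1}^d H(y^m_i)$, where $\mathbf{y}=\mathbf{W}\mathbf{z}$, has a minimum over $\mathbf{W}\in\mathcal{O}^D$. Then it is sufficient to search for the minimum of the ISA task among permutations of solutions of the ICA task; that is, there exist a minimizer $\mathbf{W}_{\mathrm{ICA}}$ of $J_{\mathrm{ICA}}$ over $\mathcal{O}^D$ and a permutation matrix $\mathbf{P}\in\mathbb{R}^{D\times D}$ such that $$\mathbf{W}_{\mathrm{ISA}}=\mathbf{P}\,\mathbf{W}_{\mathrm{ICA}}$$ minimizes the ISA cost function $J_{\mathrm{ISA}}(\mathbf{W})=\sum_{m=1}^M H(\mathbf{y}^m)$, $\mathbf{y}=\mathbf{W}\mathbf{z}$, over $\mathcal{O}^D$.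
   Context: $\mathcal{O}^D$ is the set of $D\times D$ real orthogonal matrices; $S^d:=\{\mathbf{w}\in\mathbb{R}^d:\|\mathbf{w}\|=1\}$ (Euclidean norm). $[\mathbf{a};\mathbf{b}]$ denotes vertical concatenation of column vectors. $H$ denotes Shannon's (possibly multi-dimensional) differential entropy with natural logarithm. ISA (Independent Subspace Analysis) model: $\mathbf{s}^1,\ldots,\mathbf{s}^M$ are mutually independent continuous random vectors in $\mathbb{R}^d$ (the coordinates within one $\mathbf{s}^m$ need not be independent), having densities and finite differential entropies $H(\mathbf{s}^m)$. The observation is $\mathbf{z}=\mathbf{A}\mathbf{s}$ with an invertible mixing matrix $\mathbf{A}\in\mathbb{R}^{D\times D}$. Both $\mathbf{s}$ and $\mathbf{z}$ are white: $E[\mathbf{s}]=E[\mathbf{z}]=\mathbf{0}$, $E[\mathbf{s}\mathbf{s}^T]=E[\mathbf{z}\mathbf{z}^T]=\mathbf{I}_D$; hence $\mathbf{A}\in\mathcal{O}^D$. For $\mathbf{W}\in\mathcal{O}^D$ write $\mathbf{y}=\mathbf{W}\mathbf{z}=[\mathbf{y}^1;\ldots;\mathbf{y}^M]$ with $\mathbf{y}^m\in\mathbb{R}^d$, and $y^m_i$ for the $i$-th coordinate of $\mathbf{y}^m$. The ISA task is to minimize the mutual information $I(\mathbf{y}^1,\ldots,\mathbf{y}^M)$ over $\mathbf{W}\in\mathcal{O}^D$, equivalently to minimize $J_{\mathrm{ISA}}(\mathbf{W})=\sum_{m=1}^M H(\mathbf{y}^m)$. The ICA task is to minimize $J_{\mathrm{ICA}}(\mathbf{W})=\sum_{m=1}^M\sum_{i=1}^d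 H(y^m_i)$ over $\mathcal{O}^D$. *)

theory Defs
  imports "HOL-Probability.Probability"
begin

text \<open>
  The space of dimension \<open>D = d M\<close> is \<open>real ^ ('m \<times> 'd)\<close> with \<open>CARD('m) = M\<close> and \<open>CARD('d) = d\<close>:
  the coordinate with index \<open>(m, i)\<close> is the \<open>i\<close>-th coordinate of the \<open>m\<close>-th block.
\<close>

definition stack :: "('m \<Rightarrow> real ^ 'd) \<Rightarrow> real ^ ('m::finite \<times> 'd::finite)"
  where "stack v = (\<chi> k. v (fst k) $ snd k)"

definition block :: "'m \<Rightarrow> real ^ ('m::finite \<times> 'd::finite) \<Rightarrow> real ^ 'd"
  where "block m y = (\<chi> i. y $ (m, i))"

text \<open>
  Shannon's differential entropy \<open>- \<integral> f ln f\<close>, where \<open>f\<close> is the Lebesgue density of \<open>X\<close>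
  (see \<open>information_space.entropy_distr\<close>). The value is meaningful only if \<open>X\<close> has a density
  \<open>f\<close> with \<open>f ln f\<close> integrable. If a random vector with integrable squared norm has this property,
  then so does each of its images under a surjective linear map.
\<close>

definition diff_entropy :: "'a measure \<Rightarrow> ('a \<Rightarrow> 'b::euclidean_space) \<Rightarrow> real"
  where "diff_entropy M X = prob_space.entropy M (exp 1) lborel X"

definition white :: "'a measure \<Rightarrow> ('a \<Rightarrow> real ^ 'n) \<Rightarrow> bool"
  where "white M X \<longleftrightarrow>
    has_bochner_integral M X 0 \<and>
    has_bochner_integral M (\<lambda>\<omega>. \<chi> i j. X \<omega> $ i * X \<omega> $ j) (mat 1 :: real ^ 'n ^ 'n)"

definition permutation_matrix :: "real ^ 'n ^ 'n \<Rightarrow> bool"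
  where "permutation_matrix P \<longleftrightarrow>
    (\<exists>p. p permutes UNIV \<and> P = (\<chi> i j. if j = p i then 1 else 0))"

definition J_ISA ::
    "'a measure \<Rightarrow> ('a \<Rightarrow> real ^ ('m::finite \<times> 'd::finite)) \<Rightarrow> real ^ ('m \<times> 'd) ^ ('m \<times> 'd) \<Rightarrow> real"
  where "J_ISA M z W = (\<Sum>m\<in>UNIV. diff_entropy M (\<lambda>\<omega>. block m (W *v z \<omega>)))"

definition J_ICA ::
    "'a measure \<Rightarrow> ('a \<Rightarrow> real ^ ('m::finite \<times> 'd::finite)) \<Rightarrow> real ^ ('m \<times> 'd) ^ ('m \<times> 'd) \<Rightarrow> real"
  where "J_ICA M z W =
    (\<Sum>m\<in>UNIV. \<Sum>i\<in>UNIV. diff_entropy M (\<lambda>\<omega>. block m (W *v z \<omega>) $ i))"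

end

theory Submission
  imports Defs
begin

text \<open>
  Whiteness forces \<open>A\<close> to be orthogonal, and \<open>A\<^sup>T\<close> minimizes both cost functions, so \<open>P\<close> can be
  the identity. For \<open>J_ISA\<close> this is subadditivity of entropy, since \<open>W z = W A s\<close> has the same joint
  entropy as \<open>s\<close>. For \<open>J_ICA\<close>, a coordinate of \<open>W A s\<close> is a weighted sum of independent unit
  combinations of the \<open>s m\<close>. The entropy power inequality in its linear form
  \<open>H (\<Sum>m. c m * X m) \<ge> \<Sum>m. (c m)\<^sup>2 * H (X m)\<close>, followed by the hypothesis, bounds its entropy from
  below by a combination of the \<open>H (s m $ i)\<close> with the squared matrix entries as weights; the columns of
  the matrix being unit vectors, these weights add up to one over all coordinates.

  The entropy power inequality is proved by transport, as in Rioul's proof. After adding a small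
  independent Gaussian variable, \<open>X m = T m (N m)\<close> for independent standard Gaussian \<open>N m\<close> and increasing
  differentiable \<open>T m\<close>. Along the direction \<open>c\<close> the map \<open>x \<mapsto> \<Sum>m. c m * T m (x m)\<close> has derivative
  \<open>\<Sum>m. (c m)\<^sup>2 * T' m (x m)\<close>, whose logarithm is at least \<open>\<Sum>m. (c m)\<^sup>2 * ln (T' m (x m))\<close>; a one-dimensional
  substitution compares it with any test density \<open>q\<close>. The Gaussian perturbation is removed while
  \<open>ln q\<close> is continuous with quadratic growth, and only then \<open>q\<close> tends to the density of the sum.
\<close>

section \<open>Gibbs' inequality and Gaussian smoothing\<close>

text \<open>Every comparison of entropies rests on one inequality:
  \<open>expectation k \<le> ln C\<close> if \<open>exp k\<close> has integral at most
  \<open>C\<close>. Entropies are handled as integrals of \<open>ln p\<close> against the law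
  itself, that is with the opposite sign, so lower bounds on entropy appear as upper bounds.
  Smoothing is forced by the transport: for a merely measurable density \<open>T m\<close> need not
  be differentiable. Removing it directly from the entropy of the sum would need upper
  semicontinuity of entropy; a fixed test density \<open>q\<close> replaces this by the convergence
  of integrals of one continuous function. For the summands nothing has to converge, because
  smoothing only increases their entropies. The other obstacle is definedness: a Bochner integral
  that does not exist has value 0, so the entropies entering Gibbs' inequality or the entropy power
  inequality must first be shown finite. The means is comparison with the Gaussian measure, whose
  log density is integrable as soon as second moments exist.\<close>

lemma (in prob_space) expectation_le_ln_nn_integral_exp:
  fixes k :: "'a \<Rightarrow> real"
  assumes k: "integrable M k" and C: "(\<integral>\<^sup>+x. ennreal (exp (k x)) \<partial>M) \<le> ennreal C" "0 < C"
  shows "expectation k \<le> ln C"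
proof -
  have [measurable]: "k \<in> borel_measurable M" using k by auto
  have int: "integrable M (\<lambda>x. exp (k x))"
    using C by (intro integrableI_nonneg) (auto simp: less_top[symmetric] top_unique)
  have "ennreal (expectation (\<lambda>x. exp (k x))) \<le> ennreal C"
    using C by (subst nn_integral_eq_integral[symmetric]) (auto simp: int)
  then have le: "expectation (\<lambda>x. exp (k x)) \<le> C"
    using C by simp
  \<comment> \<open>The tangent of \<open>exp\<close> at \<open>ln C\<close>, rearranged. It yields
    Jensen's inequality with a bound \<open>C\<close> in place of the exact expectation.\<close>
  have "k x \<le> ln C + exp (k x) / C - 1" for x
  proof -
    have "1 + (k x - ln C) \<le> exp (k x - ln C)" by (rule exp_ge_add_one_self)
    also have "\<dots> = exp (k x) / C" using C by (simp add: exp_diff)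
    finally show ?thesis by simp
  qed
  then have "expectation k \<le> expectation (\<lambda>x. ln C + exp (k x) / C - 1)"
    using int k by (intro integral_mono) auto
  also have "\<dots> = ln C + expectation (\<lambda>x. exp (k x)) / C - 1"
    using int by (simp add: prob_space)
  also have "\<dots> \<le> ln C" using le C by simp
  finally show ?thesis .
qed

text \<open>A real-valued version that is nonnegative everywhere, so that \<open>ln (p x)\<close>
  can be written without side conditions. The value of \<open>ln\<close> at 0 never matters, since
  \<mu> does not charge the zero set of \<open>p\<close>. The entropy becomes minus the integral of
  \<open>ln (p x)\<close> with respect to \<mu>.\<close>

definition lebesgue_density :: "'b::euclidean_space measure \<Rightarrow> ('b \<Rightarrow> real) \<Rightarrow> bool"
  where "lebesgue_density \<mu> p \<longleftrightarrow>
    p \<in> borel_measurable borel \<and> (\<forall>x. 0 \<le> p x) \<and> \<mu> = density lborel (\<lambda>x. ennreal (p x)) \<and> prob_space \<mu>"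

lemma lebesgue_densityD:
  assumes "lebesgue_density \<mu> p"
  shows "p \<in> borel_measurable borel" "0 \<le> p x" "\<mu> = density lborel (\<lambda>x. ennreal (p x))"
    "prob_space \<mu>" "sets \<mu> = sets borel" "space \<mu> = UNIV"
  using assms by (auto simp: lebesgue_density_def)

lemma AE_lebesgue_density_pos:
  assumes "lebesgue_density \<mu> p"
  shows "AE x in \<mu>. 0 < p x"
proof -
  note [measurable] = lebesgue_densityD(1)[OF assms]
  show ?thesis
    using assms unfolding lebesgue_density_def
    by (auto simp: AE_density ennreal_less_zero_iff)
qed

lemma nn_integral_lebesgue_density:
  assumes "lebesgue_density \<mu> p" and [measurable]: "g \<in> borel_measurable borel"
  shows "(\<integral>\<^sup>+x. g x \<partial>\<mu>) = (\<integral>\<^sup>+x. ennreal (p x) * g x \<partial>lborel)"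
proof -
  note [measurable] = lebesgue_densityD(1)[OF assms(1)]
  show ?thesis
    by (subst lebesgue_densityD(3)[OF assms(1)], subst nn_integral_density) auto
qed

text \<open>Only an inequality, because the mass of \<open>q\<close> on the zero set of
  \<open>p\<close> is lost: there the quotient is 0 by convention and \<mu> has no mass.\<close>

lemma nn_integral_lebesgue_density_divide_le:
  assumes "lebesgue_density \<mu> p" and [measurable]: "q \<in> borel_measurable borel"
    and "\<And>x. 0 \<le> q x"
  shows "(\<integral>\<^sup>+x. ennreal (q x / p x) \<partial>\<mu>) \<le> (\<integral>\<^sup>+x. ennreal (q x) \<partial>lborel)"
proof -
  note [measurable] = lebesgue_densityD(1)[OF assms(1)]
  have "0 \<le> p x" for x using lebesgue_densityD(2)[OF assms(1)] .
  then have "ennreal (p x) * ennreal (q x / p x) \<le> ennreal (q x)" for x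
    using assms(3)[of x] by (cases "p x = 0") (auto simp: ennreal_mult[symmetric])
  then show ?thesis
    by (subst nn_integral_lebesgue_density[OF assms(1)]) (auto intro!: nn_integral_mono)
qed

text \<open>Nonnegativity of relative entropy: under \<mu> the exponential of
  \<open>ln (q x) - ln (p x)\<close> is almost everywhere \<open>q x / p x\<close>, whose integral
  is at most the mass of \<open>q\<close>.\<close>

lemma Gibbs_inequality_ln:
  fixes p :: "'b::euclidean_space \<Rightarrow> real"
  assumes p: "lebesgue_density \<mu> p" "integrable \<mu> (\<lambda>x. ln (p x))"
    and q: "q \<in> borel_measurable borel" "\<And>x. 0 \<le> q x" "AE x in \<mu>. 0 < q x"
      "(\<integral>\<^sup>+x. ennreal (q x) \<partial>lborel) \<le> ennreal C" "0 < C" "integrable \<mu> (\<lambda>x. ln (q x))"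
  shows "(\<integral>x. ln (q x) \<partial>\<mu>) \<le> (\<integral>x. ln (p x) \<partial>\<mu>) + ln C"
proof -
  interpret prob_space \<mu> using lebesgue_densityD[OF p(1)] by simp
  have "(\<integral>\<^sup>+x. ennreal (exp (ln (q x) - ln (p x))) \<partial>\<mu>) = (\<integral>\<^sup>+x. ennreal (q x / p x) \<partial>\<mu>)"
    by (intro nn_integral_cong_AE) (use q(3) AE_lebesgue_density_pos[OF p(1)] in \<open>eventually_elim, simp add: exp_diff\<close>)
  also have "\<dots> \<le> (\<integral>\<^sup>+x. ennreal (q x) \<partial>lborel)"
    using p q by (intro nn_integral_lebesgue_density_divide_le) auto
  finally have "expectation (\<lambda>x. ln (q x) - ln (p x)) \<le> ln C"
    using p q by (intro expectation_le_ln_nn_integral_exp) auto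
  then show ?thesis using p q by simp
qed

section \<open>Convolution with a Gaussian: the law of \<open>u + \<epsilon> * n\<close> with
  \<open>n\<close> standard normal\<close>

definition smooth_density :: "real measure \<Rightarrow> real \<Rightarrow> real \<Rightarrow> real"
  where "smooth_density \<mu> \<epsilon> x = (\<integral>u. normal_density u \<epsilon> x \<partial>\<mu>)"

definition smooth :: "real measure \<Rightarrow> real \<Rightarrow> real measure"
  where "smooth \<mu> \<epsilon> = density lborel (\<lambda>x. ennreal (smooth_density \<mu> \<epsilon> x))"

lemma normal_density_le: "0 < \<epsilon> \<Longrightarrow> normal_density u \<epsilon> x \<le> 1 / sqrt (2 * pi * \<epsilon>\<^sup>2)"
  unfolding normal_density_def by (simp add: divide_right_mono)

lemma normal_density_scale: "0 < \<epsilon> \<Longrightarrow> \<epsilon> * normal_density u \<epsilon> (u + \<epsilon> * n) = std_normal_density n"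
  by (simp add: normal_density_def power_mult_distrib real_sqrt_mult)

lemma ln_normal_density:
  "0 < \<epsilon> \<Longrightarrow> ln (normal_density u \<epsilon> x) = - ln (sqrt (2 * pi * \<epsilon>\<^sup>2)) - (x - u)\<^sup>2 / (2 * \<epsilon>\<^sup>2)"
  by (simp add: normal_density_def ln_mult ln_div)

lemma borel_measurable_normal_density_mean [measurable]:
  "(\<lambda>(u, x). normal_density u \<epsilon> x) \<in> borel_measurable (borel \<Otimes>\<^sub>M borel)"
  unfolding normal_density_def by measurable

lemma borel_measurable_normal_density_mean' [measurable]:
  "(\<lambda>u. normal_density u \<epsilon> x) \<in> borel_measurable borel"
  unfolding normal_density_def by measurable

context real_distribution
begin

lemma integrable_normal_density_mean:
  "0 < \<epsilon> \<Longrightarrow> integrable M (\<lambda>u. normal_density u \<epsilon> x)"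
  by (intro integrable_const_bound[where B="1 / sqrt (2 * pi * \<epsilon>\<^sup>2)"] AE_I2)
     (simp_all add: normal_density_le abs_of_nonneg[OF normal_density_nonneg])

lemma smooth_density_le: "0 < \<epsilon> \<Longrightarrow> smooth_density M \<epsilon> x \<le> 1 / sqrt (2 * pi * \<epsilon>\<^sup>2)"
  unfolding smooth_density_def
  using integral_mono[OF integrable_normal_density_mean[of \<epsilon> x] integrable_const[of "1 / sqrt (2 * pi * \<epsilon>\<^sup>2)"]]
  by (simp add: normal_density_le prob_space del: space_eq_univ)

lemma smooth_density_pos: "0 < \<epsilon> \<Longrightarrow> 0 < smooth_density M \<epsilon> x"
proof (rule ccontr)
  assume e: "0 < \<epsilon>" and n: "\<not> 0 < smooth_density M \<epsilon> x"
  have "0 \<le> smooth_density M \<epsilon> x" unfolding smooth_density_def by simp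
  with n have "(\<integral>u. normal_density u \<epsilon> x \<partial>M) = 0" unfolding smooth_density_def by linarith
  then have "AE u in M. normal_density u \<epsilon> x = 0"
    using integral_nonneg_eq_0_iff_AE[OF integrable_normal_density_mean[OF e, of x]] by simp
  then have "AE u in M. False"
    by eventually_elim (use normal_density_pos[OF e] in \<open>force simp: less_le\<close>)
  then show False by simp
qed

lemma continuous_smooth_density: "0 < \<epsilon> \<Longrightarrow> continuous_on UNIV (smooth_density M \<epsilon>)"
proof (rule continuous_at_imp_continuous_on, intro ballI continuous_at_sequentiallyI)
  fix x :: real and y :: "nat \<Rightarrow> real" assume e: "0 < \<epsilon>" and y: "y \<longlonglongrightarrow> x"
  show "(\<lambda>n. smooth_density M \<epsilon> (y n)) \<longlonglongrightarrow> smooth_density M \<epsilon> x"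
    unfolding smooth_density_def
  proof (rule integral_dominated_convergence[where w="\<lambda>_. 1 / sqrt (2 * pi * \<epsilon>\<^sup>2)"])
    show "AE u in M. (\<lambda>n. normal_density u \<epsilon> (y n)) \<longlonglongrightarrow> normal_density u \<epsilon> x"
      unfolding normal_density_def using e by (intro AE_I2 tendsto_intros y) auto
  qed (use e integrable_normal_density_mean[OF e] in \<open>auto simp: normal_density_le simp del: space_eq_univ\<close>)
qed

lemma borel_measurable_smooth_density [measurable]: "0 < \<epsilon> \<Longrightarrow> smooth_density M \<epsilon> \<in> borel_measurable borel"
  using continuous_smooth_density by (intro borel_measurable_continuous_onI)

text \<open>Jensen's inequality moves \<open>ln\<close> inside the mixture over \<open>u\<close>,
  where the Gaussian exponent is explicit. The gain is a lower bound of quadratic growth in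
  \<open>x\<close>, which every law with a second moment can integrate, however thin the tails of
  \<open>M\<close> are.\<close>

lemma ln_smooth_density_ge:
  assumes e: "0 < \<epsilon>" and m: "integrable M (\<lambda>u. u\<^sup>2)"
  shows "- ln (sqrt (2 * pi * \<epsilon>\<^sup>2)) - (x\<^sup>2 + (\<integral>u. u\<^sup>2 \<partial>M)) / \<epsilon>\<^sup>2 \<le> ln (smooth_density M \<epsilon> x)"
proof -
  have int: "integrable M (\<lambda>u. (x - u)\<^sup>2)"
  proof -
    have "integrable M (\<lambda>u. u)" using m by (rule square_integrable_imp_integrable[rotated]) simp
    then show ?thesis using m by (simp add: power2_diff)
  qed
  have "(x - u)\<^sup>2 \<le> 2 * x\<^sup>2 + 2 * u\<^sup>2" for u
    using zero_le_power2[of "x + u"] by (simp add: power2_eq_square algebra_simps)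
  then have "(\<integral>u. (x - u)\<^sup>2 \<partial>M) \<le> (\<integral>u. 2 * x\<^sup>2 + 2 * u\<^sup>2 \<partial>M)"
    using int m by (intro integral_mono) auto
  also have "\<dots> = 2 * x\<^sup>2 + 2 * (\<integral>u. u\<^sup>2 \<partial>M)" using m by (simp add: prob_space del: space_eq_univ)
  finally have le: "(\<integral>u. (x - u)\<^sup>2 \<partial>M) / (2 * \<epsilon>\<^sup>2) \<le> (x\<^sup>2 + (\<integral>u. u\<^sup>2 \<partial>M)) / \<epsilon>\<^sup>2"
    using e by (simp add: divide_simps)
  have "expectation (\<lambda>u. ln (normal_density u \<epsilon> x)) \<le> ln (smooth_density M \<epsilon> x)"
  proof (rule expectation_le_ln_nn_integral_exp)
    show "integrable M (\<lambda>u. ln (normal_density u \<epsilon> x))"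
      using int by (simp add: ln_normal_density e)
    show "(\<integral>\<^sup>+ u. ennreal (exp (ln (normal_density u \<epsilon> x))) \<partial>M) \<le> ennreal (smooth_density M \<epsilon> x)"
      unfolding smooth_density_def
      by (subst nn_integral_eq_integral[symmetric]) (auto simp: integrable_normal_density_mean e normal_density_pos)
  qed (rule smooth_density_pos[OF e])
  moreover have "expectation (\<lambda>u. ln (normal_density u \<epsilon> x)) = - ln (sqrt (2 * pi * \<epsilon>\<^sup>2)) - (\<integral>u. (x - u)\<^sup>2 \<partial>M) / (2 * \<epsilon>\<^sup>2)"
    using int by (simp add: ln_normal_density e prob_space del: space_eq_univ)
  ultimately show ?thesis using le by linarith
qed

lemma abs_ln_smooth_density_le:
  assumes e: "0 < \<epsilon>" and m: "integrable M (\<lambda>u. u\<^sup>2)"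
  shows "\<bar>ln (smooth_density M \<epsilon> x)\<bar> \<le> \<bar>ln (sqrt (2 * pi * \<epsilon>\<^sup>2))\<bar> + (x\<^sup>2 + (\<integral>u. u\<^sup>2 \<partial>M)) / \<epsilon>\<^sup>2"
proof -
  have "ln (smooth_density M \<epsilon> x) \<le> ln (1 / sqrt (2 * pi * \<epsilon>\<^sup>2))"
    using smooth_density_pos[OF e] smooth_density_le[OF e] e by (intro ln_mono) (auto simp: zero_less_mult_iff)
  also have "\<dots> = - ln (sqrt (2 * pi * \<epsilon>\<^sup>2))" using e by (simp add: ln_div)
  finally have "ln (smooth_density M \<epsilon> x) \<le> - ln (sqrt (2 * pi * \<epsilon>\<^sup>2))" .
  moreover have "0 \<le> (x\<^sup>2 + (\<integral>u. u\<^sup>2 \<partial>M)) / \<epsilon>\<^sup>2" by simp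
  ultimately show ?thesis using ln_smooth_density_ge[OF e m, of x] by linarith
qed

lemma nn_integral_smooth:
  assumes e: "0 < \<epsilon>" and [measurable]: "g \<in> borel_measurable borel"
  shows "(\<integral>\<^sup>+x. g x \<partial>smooth M \<epsilon>) = (\<integral>\<^sup>+n. \<integral>\<^sup>+u. g (u + \<epsilon> * n) \<partial>M \<partial>std_normal_distribution)"
proof -
  note [measurable] = borel_measurable_smooth_density[OF e]
  interpret P: pair_sigma_finite lborel M
    by (intro pair_sigma_finite.intro sigma_finite_lborel) unfold_locales
  have "(\<integral>\<^sup>+x. g x \<partial>smooth M \<epsilon>) = (\<integral>\<^sup>+x. ennreal (smooth_density M \<epsilon> x) * g x \<partial>lborel)"
    unfolding smooth_def by (intro nn_integral_density) auto
  also have "\<dots> = (\<integral>\<^sup>+x. \<integral>\<^sup>+u. ennreal (normal_density u \<epsilon> x) * g x \<partial>M \<partial>lborel)"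
    unfolding smooth_density_def
    by (subst nn_integral_eq_integral[symmetric])
       (auto simp: integrable_normal_density_mean e nn_integral_multc)
  also have "\<dots> = (\<integral>\<^sup>+u. \<integral>\<^sup>+x. ennreal (normal_density u \<epsilon> x) * g x \<partial>lborel \<partial>M)"
    by (rule P.Fubini'[symmetric]) simp
  also have "\<dots> = (\<integral>\<^sup>+u. \<integral>\<^sup>+n. ennreal (std_normal_density n) * g (u + \<epsilon> * n) \<partial>lborel \<partial>M)"
  proof (rule nn_integral_cong)
    fix u
    have "(\<integral>\<^sup>+x. ennreal (normal_density u \<epsilon> x) * g x \<partial>lborel) =
      \<epsilon> * (\<integral>\<^sup>+n. ennreal (normal_density u \<epsilon> (u + \<epsilon> * n)) * g (u + \<epsilon> * n) \<partial>lborel)"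
      using e by (subst nn_integral_real_affine[where c=\<epsilon> and t=u]) auto
    also have "\<dots> = (\<integral>\<^sup>+n. ennreal (\<epsilon> * normal_density u \<epsilon> (u + \<epsilon> * n)) * g (u + \<epsilon> * n) \<partial>lborel)"
      using e by (subst nn_integral_cmult[symmetric]) (auto simp: ennreal_mult' ac_simps)
    finally show "(\<integral>\<^sup>+x. ennreal (normal_density u \<epsilon> x) * g x \<partial>lborel) = (\<integral>\<^sup>+n. ennreal (std_normal_density n) * g (u + \<epsilon> * n) \<partial>lborel)"
      by (simp add: normal_density_scale e)
  qed
  also have "\<dots> = (\<integral>\<^sup>+n. \<integral>\<^sup>+u. ennreal (std_normal_density n) * g (u + \<epsilon> * n) \<partial>M \<partial>lborel)"
    by (rule P.Fubini') simp
  also have "\<dots> = (\<integral>\<^sup>+n. \<integral>\<^sup>+u. g (u + \<epsilon> * n) \<partial>M \<partial>std_normal_distribution)"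
    by (subst nn_integral_density) (auto simp: nn_integral_cmult)
  finally show ?thesis .
qed

end

context real_distribution
begin

lemma smooth_eq_distr:
  assumes e: "0 < \<epsilon>"
  shows "smooth M \<epsilon> = distr (std_normal_distribution \<Otimes>\<^sub>M M) borel (\<lambda>(n, u). u + \<epsilon> * n)"
proof (rule measure_eqI)
  fix A assume "A \<in> sets (smooth M \<epsilon>)"
  then have [measurable]: "A \<in> sets borel" by (simp add: smooth_def)
  have "emeasure (smooth M \<epsilon>) A = (\<integral>\<^sup>+x. indicator A x \<partial>smooth M \<epsilon>)"
    by (simp add: smooth_def)
  also have "\<dots> = (\<integral>\<^sup>+n. \<integral>\<^sup>+u. indicator A (u + \<epsilon> * n) \<partial>M \<partial>std_normal_distribution)"
    by (rule nn_integral_smooth[OF e]) simp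
  also have "\<dots> = (\<integral>\<^sup>+z. indicator A (case z of (n, u) \<Rightarrow> u + \<epsilon> * n) \<partial>(std_normal_distribution \<Otimes>\<^sub>M M))"
    by (subst nn_integral_fst[symmetric]) auto
  also have "\<dots> = (\<integral>\<^sup>+x. indicator A x \<partial>distr (std_normal_distribution \<Otimes>\<^sub>M M) borel (\<lambda>(n, u). u + \<epsilon> * n))"
    by (subst nn_integral_distr) auto
  also have "\<dots> = emeasure (distr (std_normal_distribution \<Otimes>\<^sub>M M) borel (\<lambda>(n, u). u + \<epsilon> * n)) A"
    by simp
  finally show "emeasure (smooth M \<epsilon>) A = emeasure (distr (std_normal_distribution \<Otimes>\<^sub>M M) borel (\<lambda>(n, u). u + \<epsilon> * n)) A" .
qed (simp add: smooth_def)

lemma pair_prob_space_std_normal: "pair_prob_space std_normal_distribution M"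
proof -
  interpret N: real_distribution std_normal_distribution by (rule real_dist_normal_dist)
  show ?thesis ..
qed

lemma lebesgue_density_smooth: "0 < \<epsilon> \<Longrightarrow> lebesgue_density (smooth M \<epsilon>) (smooth_density M \<epsilon>)"
proof -
  assume e: "0 < \<epsilon>"
  interpret P: pair_prob_space std_normal_distribution M by (rule pair_prob_space_std_normal)
  have "prob_space (smooth M \<epsilon>)"
    unfolding smooth_eq_distr[OF e] by (intro P.prob_space_distr) auto
  then show ?thesis
    using borel_measurable_smooth_density[OF e] smooth_density_pos[OF e]
    by (auto simp: lebesgue_density_def smooth_def intro: less_imp_le)
qed

lemma real_distribution_smooth: "0 < \<epsilon> \<Longrightarrow> real_distribution (smooth M \<epsilon>)"
  using lebesgue_densityD[OF lebesgue_density_smooth]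
  by (intro real_distribution.intro real_distribution_axioms.intro) auto

lemma char_smooth:
  assumes e: "0 < \<epsilon>"
  shows "char (smooth M \<epsilon>) t = char M t * exp (- (\<epsilon> * t)\<^sup>2 / 2)"
proof -
  interpret P: pair_prob_space std_normal_distribution M by (rule pair_prob_space_std_normal)
  have int: "integrable (std_normal_distribution \<Otimes>\<^sub>M M) (\<lambda>(n, u). iexp (t * (u + \<epsilon> * n)))"
    by (rule P.integrable_const_bound[where B=1]) (auto simp: case_prod_beta')
  have "char (smooth M \<epsilon>) t = (\<integral>(n, u). iexp (t * (u + \<epsilon> * n)) \<partial>(std_normal_distribution \<Otimes>\<^sub>M M))"
    unfolding char_def smooth_eq_distr[OF e]
    by (subst integral_distr) (auto simp: case_prod_beta')
  also have "\<dots> = (\<integral>n. \<integral>u. iexp (t * (u + \<epsilon> * n)) \<partial>M \<partial>std_normal_distribution)"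
    by (rule P.integral_fst[OF int, symmetric])
  also have "\<dots> = (\<integral>n. iexp ((\<epsilon> * t) * n) * (\<integral>u. iexp (t * u) \<partial>M) \<partial>std_normal_distribution)"
    by (simp add: ring_distribs exp_add mult_ac)
  also have "\<dots> = char std_normal_distribution (\<epsilon> * t) * char M t"
    unfolding char_def  by simp
  finally show ?thesis by (simp add: char_std_normal_distribution)
qed

lemma integrable_square_smooth:
  assumes e: "0 < \<epsilon>" and m: "integrable M (\<lambda>u. u\<^sup>2)"
  shows "integrable (smooth M \<epsilon>) (\<lambda>x. x\<^sup>2)"
proof -
  interpret N: real_distribution std_normal_distribution by (rule real_dist_normal_dist)
  have sq: "(u + \<epsilon> * n)\<^sup>2 \<le> 2 * u\<^sup>2 + 2 * \<epsilon>\<^sup>2 * n\<^sup>2" for u n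
    using zero_le_power2[of "u - \<epsilon> * n"] by (simp add: power2_eq_square algebra_simps)
  have "(\<integral>\<^sup>+x. ennreal (x\<^sup>2) \<partial>smooth M \<epsilon>) = (\<integral>\<^sup>+n. \<integral>\<^sup>+u. ennreal ((u + \<epsilon> * n)\<^sup>2) \<partial>M \<partial>std_normal_distribution)"
    by (rule nn_integral_smooth[OF e]) simp
  also have "\<dots> \<le> (\<integral>\<^sup>+n. \<integral>\<^sup>+u. ennreal (2 * u\<^sup>2 + 2 * \<epsilon>\<^sup>2 * n\<^sup>2) \<partial>M \<partial>std_normal_distribution)"
    by (intro nn_integral_mono ennreal_leI sq)
  also have "\<dots> = (\<integral>\<^sup>+n. ennreal (2 * (\<integral>u. u\<^sup>2 \<partial>M) + 2 * \<epsilon>\<^sup>2 * n\<^sup>2) \<partial>std_normal_distribution)"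
    using m by (subst nn_integral_eq_integral) (auto simp: prob_space simp del: space_eq_univ)
  also have "\<dots> < \<infinity>"
    using integrable_std_normal_distribution_moment[of 2] by (subst nn_integral_eq_integral) auto
  finally show ?thesis by (intro integrableI_nonneg) (auto simp: smooth_def)
qed

lemma integrable_ln_smooth_density:
  assumes e: "0 < \<epsilon>" and m: "integrable M (\<lambda>u. u\<^sup>2)"
  shows "integrable (smooth M \<epsilon>) (\<lambda>x. ln (smooth_density M \<epsilon> x))"
proof -
  interpret S: real_distribution "smooth M \<epsilon>" by (rule real_distribution_smooth[OF e])
  note [measurable] = borel_measurable_smooth_density[OF e]
  show ?thesis
  proof (rule Bochner_Integration.integrable_bound)
    show "integrable (smooth M \<epsilon>) (\<lambda>x. \<bar>ln (sqrt (2 * pi * \<epsilon>\<^sup>2))\<bar> + (x\<^sup>2 + (\<integral>u. u\<^sup>2 \<partial>M)) / \<epsilon>\<^sup>2)"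
      using integrable_square_smooth[OF e m] by simp
    show "AE x in smooth M \<epsilon>. norm (ln (smooth_density M \<epsilon> x)) \<le>
      norm (\<bar>ln (sqrt (2 * pi * \<epsilon>\<^sup>2))\<bar> + (x\<^sup>2 + (\<integral>u. u\<^sup>2 \<partial>M)) / \<epsilon>\<^sup>2)"
      using abs_ln_smooth_density_le[OF e m] by (intro AE_I2) (smt (verit) real_norm_def)
  qed simp
qed

text \<open>
  The smoothed law is a mixture of translates of \<open>M\<close>, and the Gibbs inequality applies to each of them
  with the correspondingly translated smooth density.
\<close>

lemma entropy_le_entropy_smooth:
  assumes e: "0 < \<epsilon>" and m: "integrable M (\<lambda>u. u\<^sup>2)"
    and p: "lebesgue_density M p" "integrable M (\<lambda>u. ln (p u))"
  shows "(\<integral>x. ln (smooth_density M \<epsilon> x) \<partial>smooth M \<epsilon>) \<le> (\<integral>u. ln (p u) \<partial>M)"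
proof -
  interpret P: pair_prob_space std_normal_distribution M by (rule pair_prob_space_std_normal)
  note [measurable] = borel_measurable_smooth_density[OF e]
  have int: "integrable (std_normal_distribution \<Otimes>\<^sub>M M) (\<lambda>(n, u). ln (smooth_density M \<epsilon> (u + \<epsilon> * n)))"
    using integrable_ln_smooth_density[OF e m] unfolding smooth_eq_distr[OF e]
    by (subst (asm) integrable_distr_eq) (auto simp: case_prod_beta')
  have inner: "(\<integral>u. ln (smooth_density M \<epsilon> (u + \<epsilon> * n)) \<partial>M) \<le> (\<integral>u. ln (p u) \<partial>M)" for n
  proof -
    have "(\<integral>\<^sup>+u. ennreal (smooth_density M \<epsilon> (u + \<epsilon> * n)) \<partial>lborel) = (\<integral>\<^sup>+x. ennreal (smooth_density M \<epsilon> x) \<partial>lborel)"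
      by (subst (2) nn_integral_real_affine[where c=1 and t="\<epsilon> * n"]) (auto simp: add.commute)
    also have "\<dots> = emeasure (smooth M \<epsilon>) (space (smooth M \<epsilon>))"
      unfolding smooth_def by (subst emeasure_density) auto
    also have "\<dots> = 1"
      using real_distribution_smooth[OF e] by (intro prob_space.emeasure_space_1) (simp add: real_distribution_def)
    finally have nn: "(\<integral>\<^sup>+u. ennreal (smooth_density M \<epsilon> (u + \<epsilon> * n)) \<partial>lborel) \<le> ennreal 1" by simp
    have "integrable M (\<lambda>u. ln (smooth_density M \<epsilon> (u + \<epsilon> * n)))"
    proof (rule Bochner_Integration.integrable_bound)
      show "integrable M (\<lambda>u. \<bar>ln (sqrt (2 * pi * \<epsilon>\<^sup>2))\<bar> + (2 * u\<^sup>2 + 2 * (\<epsilon> * n)\<^sup>2 + (\<integral>u. u\<^sup>2 \<partial>M)) / \<epsilon>\<^sup>2)"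
        using m by simp
      have "\<bar>ln (smooth_density M \<epsilon> (u + \<epsilon> * n))\<bar> \<le>
        \<bar>ln (sqrt (2 * pi * \<epsilon>\<^sup>2))\<bar> + (2 * u\<^sup>2 + 2 * (\<epsilon> * n)\<^sup>2 + (\<integral>u. u\<^sup>2 \<partial>M)) / \<epsilon>\<^sup>2" for u
      proof -
        have "(u + \<epsilon> * n)\<^sup>2 \<le> 2 * u\<^sup>2 + 2 * (\<epsilon> * n)\<^sup>2"
          using zero_le_power2[of "u - \<epsilon> * n"] by (simp add: power2_eq_square algebra_simps)
        then have "((u + \<epsilon> * n)\<^sup>2 + (\<integral>u. u\<^sup>2 \<partial>M)) / \<epsilon>\<^sup>2 \<le> (2 * u\<^sup>2 + 2 * (\<epsilon> * n)\<^sup>2 + (\<integral>u. u\<^sup>2 \<partial>M)) / \<epsilon>\<^sup>2"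
          by (intro divide_right_mono) auto
        then show ?thesis using abs_ln_smooth_density_le[OF e m, of "u + \<epsilon> * n"] by linarith
      qed
      then show "AE u in M. norm (ln (smooth_density M \<epsilon> (u + \<epsilon> * n))) \<le>
        norm (\<bar>ln (sqrt (2 * pi * \<epsilon>\<^sup>2))\<bar> + (2 * u\<^sup>2 + 2 * (\<epsilon> * n)\<^sup>2 + (\<integral>u. u\<^sup>2 \<partial>M)) / \<epsilon>\<^sup>2)"
        by (intro AE_I2) (smt (verit) real_norm_def)
    qed simp
    then show ?thesis
      using Gibbs_inequality_ln[OF p, of "\<lambda>u. smooth_density M \<epsilon> (u + \<epsilon> * n)" 1] nn
        smooth_density_pos[OF e] by (auto intro: less_imp_le)
  qed
  have "(\<integral>x. ln (smooth_density M \<epsilon> x) \<partial>smooth M \<epsilon>) =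
    (\<integral>(n, u). ln (smooth_density M \<epsilon> (u + \<epsilon> * n)) \<partial>(std_normal_distribution \<Otimes>\<^sub>M M))"
    unfolding smooth_eq_distr[OF e] by (subst integral_distr) (auto simp: case_prod_beta')
  also have "\<dots> = (\<integral>n. \<integral>u. ln (smooth_density M \<epsilon> (u + \<epsilon> * n)) \<partial>M \<partial>std_normal_distribution)"
    by (rule P.integral_fst[OF int, symmetric])
  also have "\<dots> \<le> (\<integral>n. \<integral>u. ln (p u) \<partial>M \<partial>std_normal_distribution)"
    using P.integrable_fst'[OF int] inner by (intro integral_mono[OF _ P.M1.integrable_const]) auto
  also have "\<dots> = (\<integral>u. ln (p u) \<partial>M)"
    using P.M1.prob_space by simp
  finally show ?thesis .
qed

end

lemma lebesgue_density_std_normal: "lebesgue_density std_normal_distribution std_normal_density"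
  using real_dist_normal_dist by (auto simp: lebesgue_density_def real_distribution_def)

section \<open>Distribution functions of positive continuous densities and monotone
  transport\<close>

context
  fixes \<mu> :: "real measure" and f :: "real \<Rightarrow> real"
  assumes dens: "lebesgue_density \<mu> f" and cont: "continuous_on UNIV f" and pos: "\<And>x. 0 < f x"
begin

interpretation real_distribution \<mu>
  using lebesgue_densityD[OF dens] by (intro real_distribution.intro real_distribution_axioms.intro) auto

lemma cdf_diff_eq_integral:
  assumes "a \<le> x"
  shows "cdf \<mu> x = cdf \<mu> a + integral {a..x} f"
proof (cases "a = x")
  case False
  note [measurable] = lebesgue_densityD(1)[OF dens]
  have int: "set_integrable lborel {a..x} f"
    by (intro borel_integrable_atLeastAtMost') (rule continuous_on_subset[OF cont], simp)
  have "ennreal (measure \<mu> {a<..x}) = emeasure \<mu> {a<..x}" by (simp add: emeasure_eq_measure)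
  also have "\<dots> = (\<integral>\<^sup>+y. ennreal (f y) * indicator {a<..x} y \<partial>lborel)"
    by (subst lebesgue_densityD(3)[OF dens], subst emeasure_density) auto
  also have "\<dots> = (\<integral>\<^sup>+y. ennreal (indicator {a..x} y *\<^sub>R f y) \<partial>lborel)"
    using AE_lborel_singleton[of a]
    by (intro nn_integral_cong_AE) (auto split: split_indicator elim!: eventually_mono)
  also have "\<dots> = ennreal (LINT y:{a..x}|lborel. f y)"
    using int unfolding set_integrable_def set_lebesgue_integral_def
    by (intro nn_integral_eq_integral AE_I2) (auto split: split_indicator intro: less_imp_le pos)
  also have "(LINT y:{a..x}|lborel. f y) = integral {a..x} f"
    by (rule set_borel_integral_eq_integral(2)[OF int])
  finally have "measure \<mu> {a<..x} = integral {a..x} f"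
    by (subst (asm) ennreal_inj) (auto intro!: Henstock_Kurzweil_Integration.integral_nonneg integrable_continuous_real continuous_on_subset[OF cont] less_imp_le[OF pos])
  with False assms show ?thesis by (simp add: cdf_diff_eq[symmetric])
qed simp

lemma has_real_derivative_cdf: "(cdf \<mu> has_real_derivative f x) (at x)"
proof -
  \<comment> \<open>Any anchor to the left of \<open>x\<close> would do; it places \<open>x\<close>
    in the interior of a compact interval on which the fundamental theorem of calculus
    applies.\<close>
  have "((\<lambda>y. integral {x - 1..y} f) has_real_derivative f x) (at x within {x - 1..x + 1})"
    by (intro integral_has_real_derivative continuous_on_subset[OF cont]) auto
  then have "((\<lambda>y. integral {x - 1..y} f) has_real_derivative f x) (at x)"
    by (subst (asm) at_within_interior) auto
  then have "((\<lambda>y. cdf \<mu> (x - 1) + integral {x - 1..y} f) has_real_derivative f x) (at x)"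
    by (auto intro!: derivative_eq_intros)
  then show ?thesis
    by (rule has_field_derivative_transform_within_open[where S="{x - 1<..<x + 1}"])
       (auto simp: cdf_diff_eq_integral[symmetric])
qed

lemma cdf_strict_mono: "x < y \<Longrightarrow> cdf \<mu> x < cdf \<mu> y"
  using DERIV_pos_imp_increasing[of x y "cdf \<mu>"] has_real_derivative_cdf pos by blast

lemma cdf_inj: "cdf \<mu> x = cdf \<mu> y \<longleftrightarrow> x = y"
  using cdf_strict_mono[of x y] cdf_strict_mono[of y x] by (cases x y rule: linorder_cases) auto

lemma cdf_pos: "0 < cdf \<mu> x" and cdf_less_1: "cdf \<mu> x < 1"
  using cdf_strict_mono[of "x - 1" x] cdf_strict_mono[of x "x + 1"] cdf_nonneg[of "x - 1"]
    cdf_bounded_prob[of "x + 1"] by auto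

lemma isCont_cdf': "isCont (cdf \<mu>) x"
  by (rule DERIV_isCont[OF has_real_derivative_cdf])

lemma cdf_surj:
  assumes "0 < p" "p < 1"
  shows "\<exists>x. cdf \<mu> x = p"
proof -
  obtain a where a: "cdf \<mu> a < p"
    using order_tendstoD(2)[OF cdf_lim_at_bot assms(1)] by (auto simp: eventually_at_bot_linorder)
  obtain b where b: "p < cdf \<mu> b"
    using order_tendstoD(1)[OF cdf_lim_at_top_prob assms(2)] by (auto simp: eventually_at_top_linorder)
  have "a \<le> b" using a b cdf_nondecreasing[of b a] by (cases "a \<le> b") auto
  then show ?thesis
    using IVT'[of "cdf \<mu>" a p b] a b isCont_cdf' by (auto intro: continuous_at_imp_continuous_on)
qed

end

context
  fixes \<mu> :: "real measure" and f :: "real \<Rightarrow> real"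
  assumes dens: "lebesgue_density \<mu> f" and cont: "continuous_on UNIV f" and pos: "\<And>x. 0 < f x"
begin

interpretation real_distribution \<mu>
  using lebesgue_densityD[OF dens] by (intro real_distribution.intro real_distribution_axioms.intro) auto

text \<open>The increasing rearrangement: \<open>T\<close> is the quantile function of \<mu> after
  the Gaussian distribution function. Positivity of \<open>f\<close> makes the distribution function
  of \<mu> injective, and together with continuity makes its inverse differentiable. Continuity of
  the derivative of \<open>T\<close> is recorded for the later substitution along lines.\<close>

lemma transport_from_std_normal:
  obtains T where "\<And>x. (T has_real_derivative std_normal_density x / f (T x)) (at x)"
    "distr std_normal_distribution borel T = \<mu>" "continuous_on UNIV (\<lambda>x. std_normal_density x / f (T x))"
proof -
  interpret N: real_distribution std_normal_distribution by (rule real_dist_normal_dist)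
  have cn: "continuous_on UNIV std_normal_density"
    unfolding std_normal_density_def by (intro continuous_intros) auto
  note N = lebesgue_density_std_normal cn normal_density_pos[OF zero_less_one]
  define \<Phi> where "\<Phi> = cdf std_normal_distribution"
  \<comment> \<open>Outside the open unit interval the value is arbitrary, which is harmless because
    \<open>\<Phi>\<close> takes its values strictly between 0 and 1.\<close>
  define G where "G p = (THE y. cdf \<mu> y = p)" for p
  have G1: "cdf \<mu> (G p) = p" if "0 < p" "p < 1" for p
    unfolding G_def by (rule theI') (use cdf_surj[OF dens cont pos that] in \<open>auto simp: cdf_inj[OF dens cont pos]\<close>)
  have G2: "G (cdf \<mu> y) = y" for y
    unfolding G_def by (auto simp: cdf_inj[OF dens cont pos])
  have dG: "(G has_real_derivative inverse (f (G p))) (at p)" if "0 < p" "p < 1" for p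
  proof (rule DERIV_inverse_function[where a=0 and b=1])
    have "isCont G (cdf \<mu> (G p))"
      by (rule isCont_inverse_function[where d=1]) (auto simp: G2 isCont_cdf'[OF dens cont pos])
    then show "isCont G p" by (simp add: G1 that)
  qed (use that G1 has_real_derivative_cdf[OF dens cont pos] pos[of "G p"] in auto)
  define T where "T x = G (\<Phi> x)" for x
  have d\<Phi>: "(\<Phi> has_real_derivative std_normal_density x) (at x)" for x
    unfolding \<Phi>_def by (rule has_real_derivative_cdf[OF N])
  have \<Phi>: "0 < \<Phi> x" "\<Phi> x < 1" for x
    unfolding \<Phi>_def by (rule cdf_pos[OF N] cdf_less_1[OF N])+
  have dT: "(T has_real_derivative std_normal_density x / f (T x)) (at x)" for x
    unfolding T_def using DERIV_chain[OF dG[OF \<Phi>] d\<Phi>, of x]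
    by (simp add: o_def field_simps)
  have cT: "continuous_on UNIV T"
    by (intro continuous_at_imp_continuous_on ballI DERIV_isCont[OF dT])
  then have [measurable]: "T \<in> borel_measurable borel" by (rule borel_measurable_continuous_onI)
  have "distr std_normal_distribution borel T = \<mu>"
  proof (rule cdf_unique)
    show "real_distribution (distr std_normal_distribution borel T)" by (intro N.real_distribution_distr) simp
    show "real_distribution \<mu>" ..
    show "cdf (distr std_normal_distribution borel T) = cdf \<mu>"
    proof
      fix y
      obtain x0 where x0: "\<Phi> x0 = cdf \<mu> y"
        using cdf_surj[OF N, of "cdf \<mu> y"] cdf_pos[OF dens cont pos] cdf_less_1[OF dens cont pos] unfolding \<Phi>_def by auto
      have "T x \<le> y \<longleftrightarrow> x \<le> x0" for x
      proof -
        have "cdf \<mu> (T x) = \<Phi> x" unfolding T_def by (rule G1[OF \<Phi>])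
        moreover have "T x \<le> y \<longleftrightarrow> cdf \<mu> (T x) \<le> cdf \<mu> y"
          using cdf_strict_mono[OF dens cont pos] cdf_nondecreasing by (meson linorder_not_less)
        moreover have "x \<le> x0 \<longleftrightarrow> \<Phi> x \<le> \<Phi> x0"
          unfolding \<Phi>_def using cdf_strict_mono[OF N] N.cdf_nondecreasing by (meson linorder_not_less)
        ultimately show ?thesis using x0 by simp
      qed
      then have "T -` {..y} = {..x0}" by auto
      then show "cdf (distr std_normal_distribution borel T) y = cdf \<mu> y"
        unfolding cdf_def by (subst measure_distr) (use x0 in \<open>auto simp: \<Phi>_def cdf_def\<close>)
    qed
  qed
  moreover have "continuous_on UNIV (\<lambda>x. std_normal_density x / f (T x))"
    by (intro continuous_intros cn continuous_on_compose2[OF cont cT]) (use pos in \<open>auto simp: less_le\<close>)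
  ultimately show thesis using that dT by blast
qed

end

section \<open>Product densities and the standard Gaussian measure\<close>

lemma prod_Basis_vec: "(\<Prod>b\<in>(Basis :: (real ^ 'n) set). g b) = (\<Prod>i\<in>UNIV. g (axis i 1))"
proof -
  have "(Basis :: (real ^ 'n) set) = range (\<lambda>i. axis i 1)" by (auto simp: Basis_vec_def)
  moreover have "inj (\<lambda>i::'n. axis i (1::real))" by (auto simp: inj_on_def axis_eq_axis)
  ultimately show ?thesis by (metis (no_types, lifting) prod.reindex_cong)
qed

lemma PiM_density:
  fixes p :: "'i \<Rightarrow> 'c::euclidean_space \<Rightarrow> real"
  assumes I: "finite I" and dens: "\<And>i. lebesgue_density (\<mu> i) (p i)"
  shows "PiM I \<mu> = density (PiM I (\<lambda>_. lborel)) (\<lambda>f. \<Prod>i\<in>I. ennreal (p i (f i)))"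
proof (rule sym, rule product_sigma_finite.PiM_eqI)
  note [measurable] = lebesgue_densityD(1)[OF dens]
  have sets_\<mu>: "sets (\<mu> i) = sets borel" for i using lebesgue_densityD(5)[OF dens] .
  interpret L: product_sigma_finite "\<lambda>_::'i. lborel :: 'c measure"
    by (intro product_sigma_finite.intro sigma_finite_lborel)
  show "product_sigma_finite \<mu>"
    by (intro product_sigma_finite.intro prob_space_imp_sigma_finite lebesgue_densityD(4)[OF dens])
  show "sets (density (PiM I (\<lambda>_. lborel)) (\<lambda>f. \<Prod>i\<in>I. ennreal (p i (f i)))) = sets (PiM I \<mu>)"
    by (auto simp: sets_\<mu> intro!: sets_PiM_cong)
  fix A assume "\<And>i. i \<in> I \<Longrightarrow> A i \<in> sets (\<mu> i)"
  then have A: "i \<in> I \<Longrightarrow> A i \<in> sets borel" for i by (simp add: sets_\<mu>)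
  then have [measurable]: "PiE I A \<in> sets (PiM I (\<lambda>_. lborel))"
    using I by (intro sets_PiM_I_finite) auto
  have "emeasure (density (PiM I (\<lambda>_. lborel)) (\<lambda>f. \<Prod>i\<in>I. ennreal (p i (f i)))) (PiE I A) =
    (\<integral>\<^sup>+f. (\<Prod>i\<in>I. ennreal (p i (f i))) * indicator (PiE I A) f \<partial>PiM I (\<lambda>_. lborel))"
    by (rule emeasure_density) auto
  also have "\<dots> = (\<integral>\<^sup>+f. (\<Prod>i\<in>I. ennreal (p i (f i)) * indicator (A i) (f i)) \<partial>PiM I (\<lambda>_. lborel))"
  proof (rule nn_integral_cong)
    fix f assume f: "f \<in> space (PiM I (\<lambda>_. lborel :: 'c measure))"
    have "indicator (PiE I A) f = (\<Prod>i\<in>I. indicator (A i) (f i) :: ennreal)"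
      using I f by (auto simp: indicator_def PiE_iff space_PiM prod_zero_iff)
    then show "(\<Prod>i\<in>I. ennreal (p i (f i))) * indicator (PiE I A) f =
      (\<Prod>i\<in>I. ennreal (p i (f i)) * indicator (A i) (f i))" by (simp add: prod.distrib)
  qed
  also have "\<dots> = (\<Prod>i\<in>I. \<integral>\<^sup>+x. ennreal (p i x) * indicator (A i) x \<partial>lborel)"
    using I A by (intro L.product_nn_integral_prod) auto
  also have "\<dots> = (\<Prod>i\<in>I. emeasure (\<mu> i) (A i))"
    using A by (intro prod.cong refl) (subst lebesgue_densityD(3)[OF dens], auto simp: emeasure_density)
  finally show "emeasure (density (PiM I (\<lambda>_. lborel)) (\<lambda>f. \<Prod>i\<in>I. ennreal (p i (f i)))) (PiE I A) =
    (\<Prod>i\<in>I. emeasure (\<mu> i) (A i))" .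
qed (fact I)

text \<open>Independence speaks of product measures on function spaces, densities live on Euclidean
  spaces. \<open>J\<close> assembles a family into one vector and \<open>pr\<close> reads off a
  component; the same argument then serves for scalars forming a vector (\<open>vec_lambda\<close>)
  and for blocks forming a stacked vector (\<open>stack\<close>).\<close>

locale lborel_product =
  fixes J :: "('i::finite \<Rightarrow> 'c::euclidean_space) \<Rightarrow> 'b::euclidean_space" and pr :: "'i \<Rightarrow> 'b \<Rightarrow> 'c"
  assumes J [measurable]: "J \<in> PiM UNIV (\<lambda>_. borel) \<rightarrow>\<^sub>M borel"
    and pr [measurable]: "\<And>i. pr i \<in> borel \<rightarrow>\<^sub>M borel"
    and pr_J [simp]: "\<And>i f. pr i (J f) = f i"
    and distr_J: "distr (PiM UNIV (\<lambda>_. lborel)) borel J = lborel"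
begin

context
  fixes \<mu> :: "'i \<Rightarrow> 'c measure" and p :: "'i \<Rightarrow> 'c \<Rightarrow> real"
  assumes dens: "\<And>i. lebesgue_density (\<mu> i) (p i)"
begin

lemma sets_PiM_lborel_product [measurable_cong]: "sets (PiM UNIV \<mu>) = sets (PiM UNIV (\<lambda>_. borel))"
  by (intro sets_PiM_cong) (auto simp: lebesgue_densityD(5)[OF dens])

lemma prob_space_PiM_lborel_product: "prob_space (PiM UNIV \<mu>)"
  by (intro prob_space_PiM lebesgue_densityD(4)[OF dens])

lemma lebesgue_density_product:
  "lebesgue_density (distr (PiM UNIV \<mu>) borel J) (\<lambda>x. \<Prod>i\<in>UNIV. p i (pr i x))"
proof -
  note [measurable] = lebesgue_densityD(1)[OF dens]
  interpret prob_space "PiM UNIV \<mu>" by (rule prob_space_PiM_lborel_product)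
  have "distr (PiM UNIV \<mu>) borel J =
    distr (density (PiM UNIV (\<lambda>_. lborel)) (\<lambda>f. ennreal (\<Prod>i\<in>UNIV. p i (pr i (J f))))) borel J"
    by (subst PiM_density[OF _ dens]) (auto simp: prod_ennreal lebesgue_densityD(2)[OF dens])
  also have "\<dots> = density (distr (PiM UNIV (\<lambda>_. lborel)) borel J) (\<lambda>x. ennreal (\<Prod>i\<in>UNIV. p i (pr i x)))"
    by (rule density_distr[symmetric]) auto
  finally have "distr (PiM UNIV \<mu>) borel J = density lborel (\<lambda>x. ennreal (\<Prod>i\<in>UNIV. p i (pr i x)))"
    by (simp add: distr_J)
  moreover have "prob_space (distr (PiM UNIV \<mu>) borel J)" by (intro prob_space_distr) simp
  ultimately show ?thesis
    by (auto simp: lebesgue_density_def prod_nonneg lebesgue_densityD(2)[OF dens])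
qed

lemma distr_pr: "distr (distr (PiM UNIV \<mu>) borel J) borel (pr i) = \<mu> i"
proof -
  have "distr (distr (PiM UNIV \<mu>) borel J) borel (pr i) = distr (PiM UNIV \<mu>) borel (\<lambda>f. f i)"
    by (subst distr_distr) (auto simp: o_def)
  also have "\<dots> = distr (PiM UNIV \<mu>) (\<mu> i) (\<lambda>f. f i)"
    by (intro distr_cong) (auto simp: lebesgue_densityD(5)[OF dens])
  also have "\<dots> = \<mu> i"
    by (rule distr_PiM_component) (auto simp: lebesgue_densityD(4)[OF dens])
  finally show ?thesis .
qed

lemma indep_vars_pr: "prob_space.indep_vars (distr (PiM UNIV \<mu>) borel J) (\<lambda>_. borel) pr UNIV"
proof -
  interpret D: prob_space "distr (PiM UNIV \<mu>) borel J"
    using lebesgue_densityD(4)[OF lebesgue_density_product] .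
  have "distr (distr (PiM UNIV \<mu>) borel J) (PiM UNIV (\<lambda>_. borel)) (\<lambda>x. \<lambda>i\<in>UNIV. pr i x) =
    distr (PiM UNIV \<mu>) (PiM UNIV (\<lambda>_. borel)) (\<lambda>f. f)"
    by (subst distr_distr) (auto simp: o_def restrict_UNIV intro!: measurable_abs_UNIV)
  also have "\<dots> = PiM UNIV \<mu>"
    by (rule distr_id2) (auto simp: sets_PiM_lborel_product)
  also have "\<dots> = PiM UNIV (\<lambda>i. distr (distr (PiM UNIV \<mu>) borel J) borel (pr i))"
    by (simp add: distr_pr)
  finally show ?thesis
    by (subst D.indep_vars_iff_distr_eq_PiM') auto
qed

end

text \<open>Independence means that the joint law on the function space is the product of the
  marginal laws; \<open>J\<close> carries this equality to the Euclidean space.\<close>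

lemma distr_J_indep_vars:
  assumes "prob_space M" "prob_space.indep_vars M (\<lambda>_. borel) X UNIV"
  shows "distr M borel (\<lambda>\<omega>. J (\<lambda>i. X i \<omega>)) = distr (PiM UNIV (\<lambda>i. distr M borel (X i))) borel J"
proof -
  interpret prob_space M by fact
  have [measurable]: "random_variable borel (X i)" for i
    using assms(2) unfolding indep_vars_def by auto
  have "PiM UNIV (\<lambda>i. distr M borel (X i)) = distr M (PiM UNIV (\<lambda>_. borel)) (\<lambda>x. \<lambda>i\<in>UNIV. X i x)"
    using assms(2) by (subst (asm) indep_vars_iff_distr_eq_PiM') auto
  then show ?thesis
    by (simp only:, subst distr_distr) (auto simp: o_def restrict_UNIV intro!: measurable_abs_UNIV)
qed

end

section \<open>Lebesgue measure as a product over coordinates and over blocks\<close>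

lemma emeasure_box_vec:
  fixes l u :: "real ^ 'n"
  assumes "\<And>i. l $ i \<le> u $ i"
  shows "emeasure lborel (box l u) = ennreal (\<Prod>i\<in>UNIV. u $ i - l $ i)"
  using assms by (subst emeasure_lborel_box) (auto simp: prod_Basis_vec inner_axis, auto simp: Basis_vec_def inner_axis)

interpretation vec: lborel_product "vec_lambda :: ('n::finite \<Rightarrow> real) \<Rightarrow> real ^ 'n" "\<lambda>i x. x $ i"
proof
  show m: "(vec_lambda :: ('n \<Rightarrow> real) \<Rightarrow> real ^ 'n) \<in> PiM UNIV (\<lambda>_. borel) \<rightarrow>\<^sub>M borel"
    by (subst borel_measurable_euclidean_space) (auto simp: Basis_vec_def inner_axis)
  show "(\<lambda>x::real ^ 'n. x $ i) \<in> borel_measurable borel" for i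
    by (intro borel_measurable_continuous_onI continuous_intros)
  interpret L: product_sigma_finite "\<lambda>_::'n. lborel :: real measure"
    by (intro product_sigma_finite.intro sigma_finite_lborel)
  have m': "(vec_lambda :: ('n \<Rightarrow> real) \<Rightarrow> real ^ 'n) \<in> PiM UNIV (\<lambda>_. lborel) \<rightarrow>\<^sub>M borel"
    using m by (simp cong: measurable_cong_sets sets_PiM_cong)
  show "distr (PiM UNIV (\<lambda>_. lborel)) borel (vec_lambda :: ('n \<Rightarrow> real) \<Rightarrow> real ^ 'n) = lborel"
  proof (rule lborel_eqI[symmetric])
    fix l u :: "real ^ 'n" assume lu: "\<And>b. b \<in> Basis \<Longrightarrow> l \<bullet> b \<le> u \<bullet> b"
    have le: "l $ i \<le> u $ i" for i using lu[of "axis i 1"] by (auto simp: Basis_vec_def inner_axis)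
    have "emeasure (distr (PiM UNIV (\<lambda>_. lborel)) borel vec_lambda) (box l u) =
      emeasure (PiM UNIV (\<lambda>_. lborel)) (vec_lambda -` box l u \<inter> space (PiM UNIV (\<lambda>_::'n. lborel :: real measure)))"
      by (rule emeasure_distr[OF m']) simp
    also have "vec_lambda -` box l u \<inter> space (PiM UNIV (\<lambda>_::'n. lborel :: real measure)) =
      (PiE UNIV (\<lambda>i. box (l $ i) (u $ i)))"
      by (auto simp: space_PiM PiE_iff mem_box_cart)
    also have "emeasure (PiM UNIV (\<lambda>_. lborel)) \<dots> = (\<Prod>i\<in>UNIV. emeasure lborel (box (l $ i) (u $ i)))"
      by (rule L.emeasure_PiM) auto
    also have "\<dots> = ennreal (\<Prod>b\<in>Basis. (u - l) \<bullet> b)"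
      using le by (simp add: prod_Basis_vec inner_axis prod_ennreal)
    finally show "emeasure (distr (PiM UNIV (\<lambda>_. lborel)) borel vec_lambda) (box l u) =
      ennreal (\<Prod>b\<in>Basis. (u - l) \<bullet> b)" .
  qed simp
qed simp

lemma block_nth [simp]: "block m y $ i = y $ (m, i)" by (simp add: block_def)
lemma stack_nth [simp]: "stack v $ k = v (fst k) $ snd k" by (simp add: stack_def)

interpretation block: lborel_product "stack :: ('m::finite \<Rightarrow> real ^ 'd::finite) \<Rightarrow> real ^ ('m \<times> 'd)" block
proof
  have [measurable]: "(\<lambda>x::real ^ 'd. x $ i) \<in> borel_measurable borel" for i by (rule vec.pr)
  show m: "(stack :: ('m \<Rightarrow> real ^ 'd) \<Rightarrow> real ^ ('m \<times> 'd)) \<in> PiM UNIV (\<lambda>_. borel) \<rightarrow>\<^sub>M borel"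
    by (subst borel_measurable_euclidean_space) (auto simp: Basis_vec_def inner_axis)
  show "(block i :: real ^ ('m \<times> 'd) \<Rightarrow> real ^ 'd) \<in> borel_measurable borel" for i
    by (subst borel_measurable_euclidean_space) (auto simp: Basis_vec_def inner_axis)
  show "block i (stack f) = f i" for i and f :: "'m \<Rightarrow> real ^ 'd" by (simp add: vec_eq_iff)
  interpret L: product_sigma_finite "\<lambda>_::'m. lborel :: (real ^ 'd) measure"
    by (intro product_sigma_finite.intro sigma_finite_lborel)
  have m': "(stack :: ('m \<Rightarrow> real ^ 'd) \<Rightarrow> real ^ ('m \<times> 'd)) \<in> PiM UNIV (\<lambda>_. lborel) \<rightarrow>\<^sub>M borel"
    using m by (simp cong: measurable_cong_sets sets_PiM_cong)
  show "distr (PiM UNIV (\<lambda>_. lborel)) borel (stack :: ('m \<Rightarrow> real ^ 'd) \<Rightarrow> real ^ ('m \<times> 'd)) = lborel"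
  proof (rule lborel_eqI[symmetric])
    fix l u :: "real ^ ('m \<times> 'd)" assume lu: "\<And>b. b \<in> Basis \<Longrightarrow> l \<bullet> b \<le> u \<bullet> b"
    have le: "l $ i \<le> u $ i" for i using lu[of "axis i 1"] by (cases i) (auto simp: Basis_vec_def inner_axis)
    have "emeasure (distr (PiM UNIV (\<lambda>_. lborel)) borel stack) (box l u) =
      emeasure (PiM UNIV (\<lambda>_. lborel)) (stack -` box l u \<inter> space (PiM UNIV (\<lambda>_::'m. lborel :: (real ^ 'd) measure)))"
      by (rule emeasure_distr[OF m']) simp
    also have "stack -` box l u \<inter> space (PiM UNIV (\<lambda>_::'m. lborel :: (real ^ 'd) measure)) =
      (PiE UNIV (\<lambda>m. box (block m l) (block m u)))"
      by (auto simp: space_PiM PiE_iff mem_box_cart)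
    also have "emeasure (PiM UNIV (\<lambda>_. lborel)) \<dots> = (\<Prod>m\<in>UNIV. emeasure lborel (box (block m l) (block m u)))"
      by (rule L.emeasure_PiM) auto
    also have "\<dots> = ennreal (\<Prod>m\<in>UNIV. \<Prod>i\<in>UNIV. u $ (m, i) - l $ (m, i))"
      using le by (simp add: emeasure_box_vec prod_ennreal prod_nonneg)
    also have "(\<Prod>m\<in>UNIV. \<Prod>i\<in>UNIV. u $ (m, i) - l $ (m, i)) = (\<Prod>b\<in>Basis. (u - l) \<bullet> b)"
      by (simp add: prod.cartesian_product prod_Basis_vec inner_axis case_prod_beta flip: UNIV_Times_UNIV)
    finally show "emeasure (distr (PiM UNIV (\<lambda>_. lborel)) borel stack) (box l u) =
      ennreal (\<Prod>b\<in>Basis. (u - l) \<bullet> b)" .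
  qed simp
qed

section \<open>The standard Gaussian measure on \<open>real ^ 'n\<close>\<close>

definition std_gauss :: "real ^ 'n \<Rightarrow> real"
  where "std_gauss x = (\<Prod>i\<in>UNIV. std_normal_density (x $ i))"

definition gaussian :: "(real ^ 'n) measure"
  where "gaussian = distr (PiM UNIV (\<lambda>_. std_normal_distribution)) borel vec_lambda"

lemma lebesgue_density_gaussian: "lebesgue_density gaussian std_gauss"
  unfolding gaussian_def std_gauss_def[abs_def]
  by (rule vec.lebesgue_density_product[OF lebesgue_density_std_normal])

lemma distr_gaussian_nth: "distr gaussian borel (\<lambda>x. x $ i) = std_normal_distribution"
  unfolding gaussian_def by (rule vec.distr_pr[OF lebesgue_density_std_normal])

lemma indep_vars_gaussian_nth: "prob_space.indep_vars gaussian (\<lambda>_. borel) (\<lambda>i x. x $ i) UNIV"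
  unfolding gaussian_def by (rule vec.indep_vars_pr[OF lebesgue_density_std_normal])

text \<open>The density factors over the blocks, so the Gaussian law is the product of block
  Gaussians and a block has its factor as law. This supplies the reference measure when the entropy
  of a block is shown to be finite.\<close>

lemma distr_gaussian_block:
  "distr (gaussian :: (real ^ ('m::finite \<times> 'd::finite)) measure) borel (block m) = gaussian"
proof -
  have "std_gauss = (\<lambda>x::real ^ ('m \<times> 'd). \<Prod>m\<in>UNIV. std_gauss (block m x))"
    by (simp add: fun_eq_iff std_gauss_def prod.cartesian_product case_prod_beta flip: UNIV_Times_UNIV)
  then have "(gaussian :: (real ^ ('m \<times> 'd)) measure) = distr (PiM UNIV (\<lambda>_. gaussian)) borel stack"
    using lebesgue_densityD(3)[OF lebesgue_density_gaussian]
      lebesgue_densityD(3)[OF block.lebesgue_density_product[OF lebesgue_density_gaussian]] by metis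
  then show ?thesis
    using block.distr_pr[OF lebesgue_density_gaussian] by metis
qed

text \<open>In this form the density visibly depends on the norm alone; rotation invariance and the
  behaviour along lines are both read off from it.\<close>

lemma std_gauss_eq: "std_gauss (x :: real ^ 'n) = (1 / sqrt (2 * pi)) ^ CARD('n) * exp (- (x \<bullet> x) / 2)"
proof -
  have "std_gauss x = (\<Prod>i\<in>(UNIV::'n set). 1 / sqrt (2 * pi)) * (\<Prod>i\<in>UNIV. exp (- (x $ i)\<^sup>2 / 2))"
    unfolding std_gauss_def std_normal_density_def prod.distrib ..
  also have "(\<Prod>i\<in>UNIV. exp (- (x $ i)\<^sup>2 / 2)) = exp (\<Sum>i\<in>UNIV. - (x $ i)\<^sup>2 / 2)"
    by (simp add: exp_sum)
  also have "(\<Sum>i\<in>UNIV. - (x $ i)\<^sup>2 / 2) = - (x \<bullet> x) / 2"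
    by (simp add: inner_vec_def power2_eq_square sum_negf sum_divide_distrib)
  finally show ?thesis by simp
qed

lemma std_gauss_pos: "0 < std_gauss x"
  by (simp add: std_gauss_eq)

lemma borel_measurable_vec_nth' [measurable]: "(\<lambda>x::real ^ 'n. x $ i) \<in> borel_measurable borel"
  by (rule vec.pr)

section \<open>The transport inequality\<close>

lemma nn_integral_lborel_shift:
  fixes K :: "'b::euclidean_space \<Rightarrow> ennreal"
  assumes [measurable]: "K \<in> borel_measurable borel"
  shows "(\<integral>\<^sup>+x. K (x + a) \<partial>lborel) = (\<integral>\<^sup>+x. K x \<partial>lborel)"
proof -
  have "(\<integral>\<^sup>+x. K x \<partial>lborel) = (\<integral>\<^sup>+x. K x \<partial>distr lborel borel ((+) a))"
    by (simp add: lborel_distr_plus)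
  also have "\<dots> = (\<integral>\<^sup>+x. K (a + x) \<partial>lborel)"
    by (rule nn_integral_distr) auto
  finally show ?thesis by (simp add: add.commute)
qed

lemma nn_integral_std_normal_density_reflect: "(\<integral>\<^sup>+t. ennreal (std_normal_density (a - t)) \<partial>lborel) = 1"
proof -
  have "(\<integral>\<^sup>+t. ennreal (std_normal_density (a - t)) \<partial>lborel) = (\<integral>\<^sup>+t. ennreal (normal_density a 1 t) \<partial>lborel)"
    by (simp add: normal_density_def power2_commute)
  also have "\<dots> = 1" by (subst nn_integral_eq_integral) auto
  finally show ?thesis .
qed

text \<open>
  Insert \<open>1 = \<integral> std_normal_density (c \<bullet> x - t) dt\<close> and translate \<open>x\<close> by \<open>t c\<close>: this integrates along the
  lines parallel to \<open>c\<close> without choosing an orthonormal basis that contains \<open>c\<close>.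
\<close>

lemma nn_integral_lborel_disintegrate:
  fixes K :: "'b::euclidean_space \<Rightarrow> ennreal"
  assumes [measurable]: "K \<in> borel_measurable borel" and c: "norm c = 1"
  shows "(\<integral>\<^sup>+x. K x \<partial>lborel) =
    (\<integral>\<^sup>+x. ennreal (std_normal_density (c \<bullet> x)) * (\<integral>\<^sup>+t. K (x + t *\<^sub>R c) \<partial>lborel) \<partial>lborel)"
proof -

  have cc: "c \<bullet> c = 1" using c by (simp add: norm_eq_1)
  have "(\<integral>\<^sup>+x. K x \<partial>lborel) = (\<integral>\<^sup>+x. \<integral>\<^sup>+t. ennreal (std_normal_density (c \<bullet> x - t)) * K x \<partial>lborel \<partial>lborel)"
    by (simp add: nn_integral_multc nn_integral_std_normal_density_reflect)
  also have "\<dots> = (\<integral>\<^sup>+t. \<integral>\<^sup>+x. ennreal (std_normal_density (c \<bullet> x - t)) * K x \<partial>lborel \<partial>lborel)"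
    by (rule lborel_pair.Fubini'[symmetric]) simp
  also have "\<dots> = (\<integral>\<^sup>+t. \<integral>\<^sup>+x. ennreal (std_normal_density (c \<bullet> x)) * K (x + t *\<^sub>R c) \<partial>lborel \<partial>lborel)"
  proof (rule nn_integral_cong)
    fix t :: real
    show "(\<integral>\<^sup>+x. ennreal (std_normal_density (c \<bullet> x - t)) * K x \<partial>lborel) =
      (\<integral>\<^sup>+x. ennreal (std_normal_density (c \<bullet> x)) * K (x + t *\<^sub>R c) \<partial>lborel)"
      by (subst nn_integral_lborel_shift[symmetric, where a="t *\<^sub>R c"]) (auto simp: inner_simps cc)
  qed
  also have "\<dots> = (\<integral>\<^sup>+x. \<integral>\<^sup>+t. ennreal (std_normal_density (c \<bullet> x)) * K (x + t *\<^sub>R c) \<partial>lborel \<partial>lborel)"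
    by (rule lborel_pair.Fubini') simp
  finally show ?thesis by (simp add: nn_integral_cmult)
qed

text \<open>Only an inequality, because \<open>\<theta>\<close> need not be onto. Substitution is
  applied on the intervals from \<open>- n\<close> to \<open>n\<close>, and monotone convergence
  exhausts the line.\<close>

lemma nn_integral_increasing_substitution_le:
  fixes q :: "real \<Rightarrow> real"
  assumes [measurable]: "q \<in> borel_measurable borel" and q: "\<And>x. 0 \<le> q x"
    and d: "\<And>x. (\<theta> has_real_derivative \<theta>' x) (at x)" and c: "continuous_on UNIV \<theta>'" and nn: "\<And>x. 0 \<le> \<theta>' x"
  shows "(\<integral>\<^sup>+t. ennreal (q (\<theta> t) * \<theta>' t) \<partial>lborel) \<le> (\<integral>\<^sup>+y. ennreal (q y) \<partial>lborel)"
proof -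
  have "continuous_on UNIV \<theta>" by (intro continuous_at_imp_continuous_on ballI DERIV_isCont[OF d])
  then have [measurable]: "\<theta> \<in> borel_measurable borel" by (rule borel_measurable_continuous_onI)
  have [measurable]: "\<theta>' \<in> borel_measurable borel" using c by (rule borel_measurable_continuous_onI)
  let ?f = "\<lambda>n t. ennreal (q (\<theta> t) * \<theta>' t) * indicator {- real n..real n} t"
  have "(\<lambda>t. ennreal (q (\<theta> t) * \<theta>' t)) = (\<lambda>t. SUP n. ?f n t)"
  proof
    fix t :: real
    obtain n :: nat where n: "\<bar>t\<bar> \<le> real n" using real_arch_simple by blast
    show "ennreal (q (\<theta> t) * \<theta>' t) = (SUP n. ?f n t)"
    proof (rule antisym)
      show "ennreal (q (\<theta> t) * \<theta>' t) \<le> (SUP n. ?f n t)"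
        using n by (intro SUP_upper2[where i=n]) (auto simp: indicator_def)
      show "(SUP n. ?f n t) \<le> ennreal (q (\<theta> t) * \<theta>' t)"
        by (intro SUP_least) (auto simp: indicator_def)
    qed
  qed
  then have "(\<integral>\<^sup>+t. ennreal (q (\<theta> t) * \<theta>' t) \<partial>lborel) = (\<integral>\<^sup>+t. (SUP n. ?f n t) \<partial>lborel)" by simp
  also have "\<dots> = (SUP n. \<integral>\<^sup>+t. ?f n t \<partial>lborel)"
  proof (rule nn_integral_monotone_convergence_SUP)
    show "incseq ?f"
    proof (intro incseq_SucI le_funI)
      fix n t
      show "?f n t \<le> ?f (Suc n) t" by (intro mult_left_mono) (auto split: split_indicator)
    qed
  qed measurable
  also have "\<dots> \<le> (\<integral>\<^sup>+y. ennreal (q y) \<partial>lborel)"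
  proof (rule SUP_least)
    fix n :: nat
    have "(\<integral>\<^sup>+t. ?f n t \<partial>lborel) = (\<integral>\<^sup>+t. ennreal (q (\<theta> t) * \<theta>' t * indicator {- real n..real n} t) \<partial>lborel)"
      by (intro nn_integral_cong) (auto simp: indicator_def)
    also have "\<dots> = (\<integral>\<^sup>+y. ennreal (q y * indicator {\<theta> (- real n)..\<theta> (real n)} y) \<partial>lborel)"
      using d c nn by (intro nn_integral_substitution[symmetric])
        (auto simp: set_borel_measurable_def intro: continuous_on_subset)
    also have "\<dots> \<le> (\<integral>\<^sup>+y. ennreal (q y) \<partial>lborel)"
      by (intro nn_integral_mono) (auto simp: indicator_def q)
    finally show "(\<integral>\<^sup>+t. ?f n t \<partial>lborel) \<le> (\<integral>\<^sup>+y. ennreal (q y) \<partial>lborel)" .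
  qed
  finally show ?thesis .
qed

lemma sum_square_eq_1: "norm (c :: real ^ 'n) = 1 \<Longrightarrow> (\<Sum>i\<in>UNIV. (c $ i)\<^sup>2) = 1"
  by (simp add: norm_eq_1 inner_vec_def power2_eq_square)

text \<open>Up to a constant factor the quotient is the exponential of minus half the squared norm
  of the component of \<open>x\<close> orthogonal to \<open>c\<close>, and that component does not
  change along \<open>c\<close>.\<close>

lemma std_gauss_divide_shift:
  fixes c :: "real ^ 'n"
  assumes c: "norm c = 1"
  shows "std_gauss (x + t *\<^sub>R c) / std_normal_density (c \<bullet> (x + t *\<^sub>R c)) = std_gauss x / std_normal_density (c \<bullet> x)"
proof -
  have cc: "c \<bullet> c = 1" using c by (simp add: norm_eq_1)
  have eq: "std_gauss y / std_normal_density (c \<bullet> y) =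
    (1 / sqrt (2 * pi)) ^ CARD('n) * sqrt (2 * pi) * exp ((c \<bullet> y)\<^sup>2 / 2 - (y \<bullet> y) / 2)" for y :: "real ^ 'n"
    unfolding std_gauss_eq std_normal_density_def exp_diff by (simp add: exp_minus field_simps)
  have "(c \<bullet> (x + t *\<^sub>R c))\<^sup>2 / 2 - ((x + t *\<^sub>R c) \<bullet> (x + t *\<^sub>R c)) / 2 = (c \<bullet> x)\<^sup>2 / 2 - (x \<bullet> x) / 2"
    by (simp add: inner_simps cc power2_eq_square inner_commute field_simps)
  then show ?thesis by (simp only: eq)
qed

text \<open>It serves twice: with weights \<open>c $ m\<close> for the sum of the transported
  variables, and with weights \<open>(c $ m)\<^sup>2\<close> for the derivative of that sum in
  direction \<open>c\<close>.\<close>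

definition weighted_map :: "('n \<Rightarrow> real) \<Rightarrow> ('n \<Rightarrow> real \<Rightarrow> real) \<Rightarrow> real ^ 'n \<Rightarrow> real"
  where "weighted_map w T x = (\<Sum>m\<in>UNIV. w m * T m (x $ m))"

context
  fixes c :: "real ^ 'n" and T T' :: "'n \<Rightarrow> real \<Rightarrow> real" and q :: "real \<Rightarrow> real" and C :: real
  assumes c: "norm c = 1"
    and T: "\<And>m x. (T m has_real_derivative T' m x) (at x)"
    and T'cont: "\<And>m. continuous_on UNIV (T' m)" and T'pos: "\<And>m x. 0 < T' m x"
    and q [measurable]: "q \<in> borel_measurable borel" and qpos: "\<And>x. 0 < q x"
    and q_le: "(\<integral>\<^sup>+x. ennreal (q x) \<partial>lborel) \<le> ennreal C"
begin

lemma borel_measurable_T [measurable]: "T m \<in> borel_measurable borel" "T' m \<in> borel_measurable borel"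
proof -
  have "continuous_on UNIV (T m)" by (intro continuous_at_imp_continuous_on ballI DERIV_isCont[OF T])
  then show "T m \<in> borel_measurable borel" by (rule borel_measurable_continuous_onI)
  show "T' m \<in> borel_measurable borel" using T'cont by (rule borel_measurable_continuous_onI)
qed

abbreviation "Theta \<equiv> weighted_map (\<lambda>m. c $ m) T"
abbreviation "Theta' \<equiv> weighted_map (\<lambda>m. (c $ m)\<^sup>2) T'"

lemma borel_measurable_Theta [measurable]: "Theta \<in> borel_measurable borel" "Theta' \<in> borel_measurable borel"
  unfolding weighted_map_def[abs_def] by measurable

lemma Theta'_nonneg: "0 \<le> Theta' x"
  unfolding weighted_map_def by (intro sum_nonneg mult_nonneg_nonneg) (auto intro: less_imp_le T'pos)

text \<open>Moving in direction \<open>c\<close> itself multiplies each weight \<open>c $ m\<close>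
  by \<open>c $ m\<close> again. Hence \<open>Theta\<close> is nondecreasing on every such line
  whatever the signs of the coordinates of \<open>c\<close>, and the substitution applies.\<close>

lemma nn_integral_line_le:
  "(\<integral>\<^sup>+t. ennreal (q (Theta (x + t *\<^sub>R c)) * Theta' (x + t *\<^sub>R c)) \<partial>lborel) \<le> ennreal C"
proof -
  have d: "((\<lambda>t. Theta (x + t *\<^sub>R c)) has_real_derivative Theta' (x + t *\<^sub>R c)) (at t)" for t
    unfolding weighted_map_def
    by (auto intro!: derivative_eq_intros DERIV_chain2[OF T] simp: power2_eq_square mult_ac)
  have "continuous_on UNIV (\<lambda>t. Theta' (x + t *\<^sub>R c))"
    unfolding weighted_map_def by (intro continuous_intros continuous_on_compose2[OF T'cont]) auto
  then have "(\<integral>\<^sup>+t. ennreal (q (Theta (x + t *\<^sub>R c)) * Theta' (x + t *\<^sub>R c)) \<partial>lborel) \<le> (\<integral>\<^sup>+y. ennreal (q y) \<partial>lborel)"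
    by (intro nn_integral_increasing_substitution_le d Theta'_nonneg) (auto intro: less_imp_le qpos)
  with q_le show ?thesis by (rule order_trans[rotated])
qed

text \<open>Dividing by the Gaussian marginal along \<open>c\<close> leaves Lebesgue measure in that
  direction, weighted by a factor \<open>\<beta>\<close> that is constant on each line. The bound on
  a single line can therefore be integrated over all lines.\<close>

lemma nn_integral_gaussian_Theta_le:
  "(\<integral>\<^sup>+x. ennreal (q (Theta x) * Theta' x / std_normal_density (c \<bullet> x)) \<partial>gaussian) \<le> ennreal C"
proof -
  note [measurable] = lebesgue_densityD(1)[OF lebesgue_density_gaussian]
  define \<beta> where "\<beta> x = std_gauss x / std_normal_density (c \<bullet> x)" for x :: "real ^ 'n"
  have [measurable]: "\<beta> \<in> borel_measurable borel" unfolding \<beta>_def[abs_def] by measurable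
  have \<beta>0: "0 \<le> \<beta> x" for x
    unfolding \<beta>_def using less_imp_le[OF std_gauss_pos[of x]] by simp
  have \<beta>: "\<beta> (x + t *\<^sub>R c) = \<beta> x" for x t unfolding \<beta>_def by (rule std_gauss_divide_shift[OF c])
  have "(\<integral>\<^sup>+x. ennreal (q (Theta x) * Theta' x / std_normal_density (c \<bullet> x)) \<partial>gaussian) =
    (\<integral>\<^sup>+x. ennreal (\<beta> x) * ennreal (q (Theta x) * Theta' x) \<partial>lborel)"
    by (subst nn_integral_lebesgue_density[OF lebesgue_density_gaussian])
       (auto simp: \<beta>_def ennreal_mult[symmetric] less_imp_le[OF std_gauss_pos] less_imp_le[OF qpos] Theta'_nonneg
         intro!: nn_integral_cong)
  also have "\<dots> = (\<integral>\<^sup>+x. ennreal (std_normal_density (c \<bullet> x)) * (\<integral>\<^sup>+t. ennreal (\<beta> x) *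
      ennreal (q (Theta (x + t *\<^sub>R c)) * Theta' (x + t *\<^sub>R c)) \<partial>lborel) \<partial>lborel)"
    by (subst nn_integral_lborel_disintegrate[OF _ c]) (auto simp: \<beta>)
  also have "\<dots> = (\<integral>\<^sup>+x. ennreal (std_normal_density (c \<bullet> x)) * (ennreal (\<beta> x) *
      (\<integral>\<^sup>+t. ennreal (q (Theta (x + t *\<^sub>R c)) * Theta' (x + t *\<^sub>R c)) \<partial>lborel)) \<partial>lborel)"
    by (subst nn_integral_cmult) auto
  also have "\<dots> \<le> (\<integral>\<^sup>+x. ennreal (std_normal_density (c \<bullet> x)) * (ennreal (\<beta> x) * ennreal C) \<partial>lborel)"
    by (intro nn_integral_mono mult_left_mono nn_integral_line_le) auto
  \<comment> \<open>The Gaussian weight that the disintegration brought in now recombines with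
    \<open>\<beta>\<close> to the full Gaussian density, which has mass 1.\<close>
  also have "\<dots> = (\<integral>\<^sup>+x. ennreal (std_gauss (x :: real ^ 'n)) * ennreal C \<partial>lborel)"
  proof (rule nn_integral_cong)
    fix x :: "real ^ 'n"
    have "std_normal_density (c \<bullet> x) * \<beta> x = std_gauss x"
      unfolding \<beta>_def using normal_density_pos[of 1 0 "c \<bullet> x"] by simp
    then have "ennreal (std_normal_density (c \<bullet> x)) * ennreal (\<beta> x) = ennreal (std_gauss x)"
      by (subst ennreal_mult[symmetric]) (auto simp: \<beta>0)
    then show "ennreal (std_normal_density (c \<bullet> x)) * (ennreal (\<beta> x) * ennreal C) = ennreal (std_gauss x) * ennreal C"
      by (simp add: mult.assoc[symmetric])
  qed
  also have "\<dots> = (\<integral>\<^sup>+x. ennreal C \<partial>(gaussian :: (real ^ 'n) measure))"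
    by (rule nn_integral_lebesgue_density[OF lebesgue_density_gaussian, symmetric]) simp
  also have "\<dots> = ennreal C"
  proof -
    interpret prob_space "gaussian :: (real ^ 'n) measure" by (rule lebesgue_densityD(4)[OF lebesgue_density_gaussian])
    show ?thesis by (simp add: emeasure_space_1)
  qed
  finally show ?thesis .
qed

text \<open>Convexity of \<open>exp\<close> is used twice: pointwise, as the weighted inequality of
  arithmetic and geometric means for the \<open>T' m (x $ m)\<close>, and then in expectation, where
  the preceding integral bound supplies \<open>C\<close>.\<close>

lemma transport_inequality:
  assumes C: "0 < C"
    and i1: "integrable gaussian (\<lambda>x. ln (q (Theta x)))"
    and i2: "\<And>m. integrable gaussian (\<lambda>x :: real ^ 'n. ln (T' m (x $ m)))"
    and i3: "integrable gaussian (\<lambda>x. ln (std_normal_density (c \<bullet> x)))"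
  shows "(\<integral>x. ln (q (Theta x)) \<partial>gaussian) + (\<Sum>m\<in>UNIV. (c $ m)\<^sup>2 * (\<integral>x. ln (T' m (x $ m)) \<partial>(gaussian :: (real ^ 'n) measure)))
    \<le> (\<integral>x. ln (std_normal_density (c \<bullet> x)) \<partial>gaussian) + ln C"
proof -
  interpret G: prob_space "gaussian :: (real ^ 'n) measure" using lebesgue_densityD(4)[OF lebesgue_density_gaussian] .
  define k where "k x = ln (q (Theta x)) + (\<Sum>m\<in>UNIV. (c $ m)\<^sup>2 * ln (T' m (x $ m))) - ln (std_normal_density (c \<bullet> x))" for x
  have "exp (k x) \<le> q (Theta x) * Theta' x / std_normal_density (c \<bullet> x)" for x
  proof -
    have "exp (\<Sum>m\<in>UNIV. (c $ m)\<^sup>2 *\<^sub>R ln (T' m (x $ m))) \<le> (\<Sum>m\<in>UNIV. (c $ m)\<^sup>2 * exp (ln (T' m (x $ m))))"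
      by (rule convex_on_sum[where C=UNIV]) (auto simp: sum_square_eq_1[OF c] exp_convex)
    also have "\<dots> = Theta' x" by (simp add: weighted_map_def T'pos)
    finally show ?thesis
      unfolding k_def exp_diff exp_add
      by (simp add: qpos normal_density_pos divide_right_mono mult_left_mono less_imp_le)
  qed
  then have "(\<integral>\<^sup>+x. ennreal (exp (k x)) \<partial>gaussian) \<le> (\<integral>\<^sup>+x. ennreal (q (Theta x) * Theta' x / std_normal_density (c \<bullet> x)) \<partial>gaussian)"
    by (intro nn_integral_mono ennreal_leI)
  also have "\<dots> \<le> ennreal C" by (rule nn_integral_gaussian_Theta_le)
  finally have "G.expectation k \<le> ln C"
    using i1 i2 i3 C by (intro G.expectation_le_ln_nn_integral_exp) (auto simp: k_def[abs_def])
  then show ?thesis using i1 i2 i3 unfolding k_def by simp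
qed

end

lemma AE_lebesgue_densityI:
  assumes "lebesgue_density \<mu> p" "AE x in lborel. P x"
  shows "AE x in \<mu>. P x"
proof -
  note [measurable] = lebesgue_densityD(1)[OF assms(1)]
  show ?thesis
    using assms(2) by (subst lebesgue_densityD(3)[OF assms(1)], subst AE_density) auto
qed

section \<open>Characteristic functions of weighted sums\<close>

lemma (in prob_space) char_distr_scale:
  assumes [measurable]: "random_variable borel X"
  shows "char (distr M borel (\<lambda>\<omega>. a * X \<omega>)) t = char (distr M borel X) (a * t)"
  unfolding char_def by (subst (1 2) integral_distr) (auto simp: mult_ac)

lemma (in prob_space) char_distr_weighted_sum:
  fixes X :: "'i::finite \<Rightarrow> 'a \<Rightarrow> real"
  assumes "indep_vars (\<lambda>_. borel) X UNIV"
  shows "char (distr M borel (\<lambda>\<omega>. \<Sum>i\<in>UNIV. c i * X i \<omega>)) t = (\<Prod>i\<in>UNIV. char (distr M borel (X i)) (c i * t))"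
proof -
  have "random_variable borel (X i)" for i using assms unfolding indep_vars_def by auto
  moreover have "indep_vars (\<lambda>_. borel) (\<lambda>i \<omega>. c i * X i \<omega>) UNIV"
    using indep_vars_compose2[OF assms, of "\<lambda>i x. c i * x" "\<lambda>_. borel"] by simp
  ultimately show ?thesis by (simp add: char_distr_sum char_distr_scale)
qed

text \<open>Independent Gaussians of equal variance, weighted by a unit vector, add up to a Gaussian
  of the same variance. Hence smoothing every summand by \<epsilon> smooths the weighted sum by
  exactly \<epsilon>.\<close>

lemma sum_exp_square:
  fixes c :: "real ^ 'n"
  assumes "norm c = 1"
  shows "(\<Prod>i\<in>UNIV. complex_of_real (exp (- (a * (c $ i * t))\<^sup>2 / 2))) = exp (- (a * t)\<^sup>2 / 2)"
proof -
  have "(\<Sum>i\<in>UNIV. - (a * (c $ i * t))\<^sup>2 / 2) = (\<Sum>i\<in>UNIV. (c $ i)\<^sup>2) * (- (a * t)\<^sup>2 / 2)"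
    unfolding sum_distrib_right by (intro sum.cong) (auto simp: power2_eq_square mult_ac)
  then have "(\<Prod>i\<in>UNIV. exp (- (a * (c $ i * t))\<^sup>2 / 2)) = exp (- (a * t)\<^sup>2 / 2)"
    by (simp only: exp_sum[symmetric] finite sum_square_eq_1[OF assms] mult_1_left)
  then show ?thesis by (simp only: of_real_prod[symmetric])
qed

lemma distr_gaussian_inner:
  fixes c :: "real ^ 'n"
  assumes "norm c = 1"
  shows "distr gaussian borel (\<lambda>x. c \<bullet> x) = std_normal_distribution"
proof (rule Levy_uniqueness)
  interpret G: prob_space "gaussian :: (real ^ 'n) measure" by (rule lebesgue_densityD(4)[OF lebesgue_density_gaussian])
  have sets[measurable_cong]: "sets (gaussian :: (real ^ 'n) measure) = sets borel"
    by (rule lebesgue_densityD(5)[OF lebesgue_density_gaussian])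
  show "real_distribution (distr gaussian borel (\<lambda>x. c \<bullet> x))" by (rule G.real_distribution_distr) measurable
  show "real_distribution std_normal_distribution" by (rule real_dist_normal_dist)
  show "char (distr gaussian borel (\<lambda>x. c \<bullet> x)) = char std_normal_distribution"
    using G.char_distr_weighted_sum[OF indep_vars_gaussian_nth, of "\<lambda>i. c $ i"] sum_exp_square[OF assms, of 1]
    by (simp add: fun_eq_iff inner_vec_def distr_gaussian_nth char_std_normal_distribution)
qed

lemma integrable_std_normal_ln: "integrable std_normal_distribution (\<lambda>x. ln (std_normal_density x))"
  using integrable_std_normal_distribution_moment[of 2] real_dist_normal_dist
  by (simp add: ln_normal_density real_distribution_def prob_space.finite_measure finite_measure.integrable_const)

context real_distribution
begin

text \<open>All smoothed laws are realised on one product space, where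
  \<open>u + \<epsilon> * n\<close> converges to \<open>u\<close> pointwise. Since the values of
  \<epsilon> are at most 1, the quadratic bound gives one integrable majorant for the whole
  sequence.\<close>

lemma tendsto_integral_smooth:
  assumes m: "integrable M (\<lambda>u. u\<^sup>2)" and g: "continuous_on UNIV g"
    and bound: "\<And>x. \<bar>g x\<bar> \<le> a + b * x\<^sup>2" and b: "0 \<le> b"
  shows "(\<lambda>n. \<integral>x. g x \<partial>smooth M (1 / real (Suc n))) \<longlonglongrightarrow> (\<integral>x. g x \<partial>M)"
proof -
  interpret P: pair_prob_space std_normal_distribution M by (rule pair_prob_space_std_normal)
  have [measurable]: "g \<in> borel_measurable borel" using g by (rule borel_measurable_continuous_onI)
  let ?e = "\<lambda>n. 1 / real (Suc n)"
  have eq: "(\<integral>x. g x \<partial>smooth M (?e n)) = (\<integral>z. g (snd z + ?e n * fst z) \<partial>(std_normal_distribution \<Otimes>\<^sub>M M))" for n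
    by (subst smooth_eq_distr) (auto simp: integral_distr case_prod_beta')
  have "(\<lambda>n. \<integral>z. g (snd z + ?e n * fst z) \<partial>(std_normal_distribution \<Otimes>\<^sub>M M)) \<longlonglongrightarrow>
    (\<integral>z. g (snd z) \<partial>(std_normal_distribution \<Otimes>\<^sub>M M))"
  proof (rule integral_dominated_convergence[where w="\<lambda>z. a + b * (2 * (snd z)\<^sup>2 + 2 * (fst z)\<^sup>2)"])
    have 1: "integrable (std_normal_distribution \<Otimes>\<^sub>M M) (\<lambda>z. (snd z)\<^sup>2)"
      using m P.integrable_product_swap_iff[of "\<lambda>z. (fst z)\<^sup>2"] P.M1.prob_space
      by (simp add: case_prod_beta' P.Fubini_integrable)
    have 2: "integrable (std_normal_distribution \<Otimes>\<^sub>M M) (\<lambda>z. (fst z)\<^sup>2)"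
      using integrable_std_normal_distribution_moment[of 2] by (intro P.Fubini_integrable) (auto simp: prob_space simp del: space_eq_univ)
    show "integrable (std_normal_distribution \<Otimes>\<^sub>M M) (\<lambda>z. a + b * (2 * (snd z)\<^sup>2 + 2 * (fst z)\<^sup>2))"
      using 1 2 by simp
    show "AE z in std_normal_distribution \<Otimes>\<^sub>M M. (\<lambda>n. g (snd z + ?e n * fst z)) \<longlonglongrightarrow> g (snd z)"
    proof (intro AE_I2)
      fix z :: "real \<times> real"
      have "(\<lambda>n. snd z + ?e n * fst z) \<longlonglongrightarrow> snd z + 0 * fst z"
        by (intro tendsto_intros LIMSEQ_Suc[OF lim_1_over_n])
      moreover have "isCont g (snd z)" using g by (simp add: continuous_on_eq_continuous_at)
      ultimately show "(\<lambda>n. g (snd z + ?e n * fst z)) \<longlonglongrightarrow> g (snd z)"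
        using isCont_tendsto_compose by fastforce
    qed
    show "AE z in std_normal_distribution \<Otimes>\<^sub>M M. norm (g (snd z + ?e n * fst z)) \<le> a + b * (2 * (snd z)\<^sup>2 + 2 * (fst z)\<^sup>2)" for n
    proof (intro AE_I2)
      fix z :: "real \<times> real"
      have "(snd z + ?e n * fst z)\<^sup>2 \<le> 2 * (snd z)\<^sup>2 + 2 * (?e n * fst z)\<^sup>2"
        using zero_le_power2[of "snd z - ?e n * fst z"] unfolding power2_sum power2_diff by linarith
      also have "(?e n * fst z)\<^sup>2 \<le> (fst z)\<^sup>2"
        unfolding power_mult_distrib by (intro mult_left_le_one_le) (auto simp: power_le_one)
      finally have "b * (snd z + ?e n * fst z)\<^sup>2 \<le> b * (2 * (snd z)\<^sup>2 + 2 * (fst z)\<^sup>2)"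
        using b by (intro mult_left_mono) auto
      then show "norm (g (snd z + ?e n * fst z)) \<le> a + b * (2 * (snd z)\<^sup>2 + 2 * (fst z)\<^sup>2)"
        using bound[of "snd z + ?e n * fst z"] unfolding real_norm_def by linarith
    qed
  qed auto
  also have "(\<integral>z. g (snd z) \<partial>(std_normal_distribution \<Otimes>\<^sub>M M)) = (\<integral>x. g x \<partial>M)"
  proof -
    have i: "integrable (std_normal_distribution \<Otimes>\<^sub>M M) (\<lambda>z. g (snd z))"
    proof -
      have "integrable M g"
      proof (rule Bochner_Integration.integrable_bound)
        show "integrable M (\<lambda>x. a + b * x\<^sup>2)" using m by simp
        show "AE x in M. norm (g x) \<le> norm (a + b * x\<^sup>2)" using bound by (intro AE_I2) (smt (verit) real_norm_def)
      qed simp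
      then show ?thesis
        using P.M1.prob_space by (intro P.Fubini_integrable) auto
    qed
    show ?thesis using P.integral_fst'[OF i] P.M1.prob_space by simp
  qed
  finally show ?thesis by (simp only: eq)
qed

end

section \<open>The entropy of a weighted sum of independent random variables\<close>

text \<open>Truncates a density ratio so that its logarithm becomes bounded. The interval contains
  1, so truncation never increases the absolute value of the logarithm; its ends are reciprocal, so
  \<open>ln (real (Suc n))\<close> bounds that value on both sides.\<close>

definition clamp_real :: "nat \<Rightarrow> real \<Rightarrow> real"
  where "clamp_real n y = max (1 / real (Suc n)) (min (real (Suc n)) y)"

lemma clamp_real_pos: "0 < clamp_real n y"
  unfolding clamp_real_def by (simp add: less_max_iff_disj)

lemma clamp_real_bounds: "1 / real (Suc n) \<le> clamp_real n y" "clamp_real n y \<le> real (Suc n)"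
proof -
  have "1 / real (Suc n) \<le> 1" by simp
  also have "1 \<le> real (Suc n)" by simp
  finally show "1 / real (Suc n) \<le> clamp_real n y" "clamp_real n y \<le> real (Suc n)"
    unfolding clamp_real_def by auto
qed

lemma clamp_real_le: "0 \<le> y \<Longrightarrow> clamp_real n y \<le> y + 1"
proof -
  have "1 / real (Suc n) \<le> 1" by simp
  then show "0 \<le> y \<Longrightarrow> clamp_real n y \<le> y + 1" unfolding clamp_real_def by linarith
qed

lemma abs_ln_clamp_real_le_ln: "\<bar>ln (clamp_real n y)\<bar> \<le> ln (real (Suc n))"
proof -
  have "ln (1 / real (Suc n)) \<le> ln (clamp_real n y)"
    using clamp_real_bounds(1) by (intro ln_mono) (auto simp: clamp_real_pos)
  moreover have "ln (clamp_real n y) \<le> ln (real (Suc n))"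
    using clamp_real_bounds(2) by (intro ln_mono) (auto simp: clamp_real_pos)
  ultimately show ?thesis by (simp add: ln_div del: of_nat_Suc)
qed

lemma abs_ln_clamp_real_le:
  assumes "0 < y"
  shows "\<bar>ln (clamp_real n y)\<bar> \<le> \<bar>ln y\<bar>"
proof -
  have n: "1 / real (Suc n) \<le> 1" "1 \<le> real (Suc n)" by simp_all
  note [simp del] = of_nat_Suc
  show ?thesis
  proof (cases "1 \<le> y")
    case True
    then have "1 \<le> clamp_real n y" "clamp_real n y \<le> y" using n unfolding clamp_real_def by (auto intro: order_trans[OF n(1)])
    then have "0 \<le> ln (clamp_real n y)" "ln (clamp_real n y) \<le> ln y" by (auto intro!: ln_mono)
    then show ?thesis by simp
  next
    case False
    then have "clamp_real n y \<le> 1" "y \<le> clamp_real n y" using n unfolding clamp_real_def by auto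
    then have "ln (clamp_real n y) \<le> 0" "ln y \<le> ln (clamp_real n y)"
      using assms clamp_real_pos[of n y] by (auto intro!: ln_mono)
    then show ?thesis by simp
  qed
qed

lemma clamp_real_tendsto: "0 \<le> y \<Longrightarrow> (\<lambda>n. clamp_real n y) \<longlonglongrightarrow> y"
proof -
  assume y: "0 \<le> y"
  have "(\<lambda>n. max (1 / real (Suc n)) y) \<longlonglongrightarrow> max 0 y"
    by (intro tendsto_intros LIMSEQ_Suc[OF lim_1_over_n])
  moreover have "\<forall>\<^sub>F n in sequentially. max (1 / real (Suc n)) y = clamp_real n y"
    using eventually_ge_at_top[of "nat \<lceil>y\<rceil>"]
  proof eventually_elim
    case (elim n)
    then have "y \<le> real (Suc n)" by linarith
    then show ?case unfolding clamp_real_def by (simp add: min_absorb2)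
  qed
  ultimately have "(\<lambda>n. clamp_real n y) \<longlonglongrightarrow> max 0 y" by (rule Lim_transform_eventually)
  then show ?thesis using y by simp
qed

lemma borel_measurable_clamp_real [measurable]: "clamp_real n \<in> borel_measurable borel"
  unfolding clamp_real_def[abs_def] by measurable

section \<open>The linear entropy power inequality, tested against densities\<close>

locale weighted_sum = prob_space M for M :: "'a measure" +
  fixes X :: "'n::finite \<Rightarrow> 'a \<Rightarrow> real" and p :: "'n \<Rightarrow> real \<Rightarrow> real" and c :: "real ^ 'n"
  assumes indep: "indep_vars (\<lambda>_. borel) X UNIV"
    and dens: "\<And>i. lebesgue_density (distr M borel (X i)) (p i)"
    and ent: "\<And>i. integrable (distr M borel (X i)) (\<lambda>x. ln (p i x))"
    and sq: "\<And>i. integrable M (\<lambda>\<omega>. (X i \<omega>)\<^sup>2)"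
    and c: "norm c = 1"
begin

lemma X_measurable [measurable]: "random_variable borel (X i)"
  using indep unfolding indep_vars_def by auto

abbreviation law :: "'n \<Rightarrow> real measure" where "law i \<equiv> distr M borel (X i)"

definition sum_law :: "real measure" where "sum_law = distr M borel (\<lambda>\<omega>. \<Sum>i\<in>UNIV. c $ i * X i \<omega>)"

text \<open>Minus the weighted mean of the entropies of the \<open>X i\<close>, that is minus the
  lower bound in the entropy power inequality.\<close>

definition mean_ln :: real where "mean_ln = (\<Sum>i\<in>UNIV. (c $ i)\<^sup>2 * (\<integral>x. ln (p i x) \<partial>law i))"

lemma real_distribution_law: "real_distribution (law i)"
  by (rule real_distribution_distr) simp

lemma real_distribution_sum_law: "real_distribution sum_law"
  unfolding sum_law_def by (rule real_distribution_distr) simp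

lemma sq_law: "integrable (law i) (\<lambda>x. x\<^sup>2)"
  using sq by (simp add: integrable_distr_eq)

lemma sq_sum_law: "integrable sum_law (\<lambda>x. x\<^sup>2)"
proof -
  have i: "integrable M (\<lambda>\<omega>. X i \<omega> * X j \<omega>)" for i j
  proof (rule Bochner_Integration.integrable_bound)
    show "integrable M (\<lambda>\<omega>. (X i \<omega>)\<^sup>2 + (X j \<omega>)\<^sup>2)" using sq by simp
    have "\<bar>a * b\<bar> \<le> a\<^sup>2 + b\<^sup>2" for a b :: real
      using zero_le_power2[of "\<bar>a\<bar> - \<bar>b\<bar>"] zero_le_power2[of a] zero_le_power2[of b]
      unfolding power2_diff abs_mult power2_abs by linarith
    then show "AE \<omega> in M. norm (X i \<omega> * X j \<omega>) \<le> norm ((X i \<omega>)\<^sup>2 + (X j \<omega>)\<^sup>2)"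
      by (intro AE_I2) (smt (verit) real_norm_def)
  qed simp
  have "integrable M (\<lambda>\<omega>. \<Sum>i\<in>UNIV. \<Sum>j\<in>UNIV. (c $ i * c $ j) * (X i \<omega> * X j \<omega>))"
    by (intro Bochner_Integration.integrable_sum integrable_mult_right i)
  then show ?thesis
    unfolding sum_law_def
    by (subst integrable_distr_eq) (auto simp: power2_eq_square sum_product mult_ac)
qed

lemma char_sum_law: "char sum_law t = (\<Prod>i\<in>UNIV. char (law i) (c $ i * t))"
  unfolding sum_law_def by (rule char_distr_weighted_sum[OF indep])

text \<open>Taking the density of the smoothed sum for \<open>q\<close> would bound the entropy of
  that sum alone. With \<open>q\<close> left free, the bound persists as \<epsilon> tends to 0. The
  right-hand side already contains the unsmoothed entropies, because smoothing increases
  entropy.\<close>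

lemma expectation_ln_le_smooth:
  assumes e: "0 < \<epsilon>"
    and q: "continuous_on UNIV q" "\<And>x. 0 < q x" "(\<integral>\<^sup>+x. ennreal (q x) \<partial>lborel) \<le> ennreal C" "0 < C"
    and bound: "\<And>x. \<bar>ln (q x)\<bar> \<le> a + b * x\<^sup>2"
  shows "(\<integral>x. ln (q x) \<partial>smooth sum_law \<epsilon>) \<le> mean_ln + ln C"
proof -
  interpret G: prob_space "gaussian :: (real ^ 'n) measure" by (rule lebesgue_densityD(4)[OF lebesgue_density_gaussian])
  have [measurable_cong]: "sets (gaussian :: (real ^ 'n) measure) = sets borel"
    by (rule lebesgue_densityD(5)[OF lebesgue_density_gaussian])
  interpret S: real_distribution sum_law by (rule real_distribution_sum_law)
  interpret S': real_distribution "smooth sum_law \<epsilon>" by (rule S.real_distribution_smooth[OF e])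
  have [measurable]: "q \<in> borel_measurable borel" using q(1) by (rule borel_measurable_continuous_onI)
  define f where "f i = smooth_density (law i) \<epsilon>" for i
  have f: "lebesgue_density (smooth (law i) \<epsilon>) (f i)" "continuous_on UNIV (f i)" "0 < f i x"
    "integrable (smooth (law i) \<epsilon>) (\<lambda>x. ln (f i x))"
    "(\<integral>x. ln (f i x) \<partial>smooth (law i) \<epsilon>) \<le> (\<integral>x. ln (p i x) \<partial>law i)" for i x
  proof -
    interpret L: real_distribution "law i" by (rule real_distribution_law)
    show "lebesgue_density (smooth (law i) \<epsilon>) (f i)" "continuous_on UNIV (f i)" "0 < f i x"
      "integrable (smooth (law i) \<epsilon>) (\<lambda>x. ln (f i x))"
      "(\<integral>x. ln (f i x) \<partial>smooth (law i) \<epsilon>) \<le> (\<integral>x. ln (p i x) \<partial>law i)"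
      unfolding f_def using e
      by (auto intro!: L.lebesgue_density_smooth L.continuous_smooth_density L.smooth_density_pos
          L.integrable_ln_smooth_density L.entropy_le_entropy_smooth sq_law dens ent)
  qed
  have "\<exists>T. (\<forall>x. (T has_real_derivative std_normal_density x / f i (T x)) (at x)) \<and>
    distr std_normal_distribution borel T = smooth (law i) \<epsilon> \<and>
    continuous_on UNIV (\<lambda>x. std_normal_density x / f i (T x))" for i
    using transport_from_std_normal[OF f(1-3)] by metis
  then obtain T where T: "\<And>i x. (T i has_real_derivative std_normal_density x / f i (T i x)) (at x)"
    "\<And>i. distr std_normal_distribution borel (T i) = smooth (law i) \<epsilon>"
    "\<And>i. continuous_on UNIV (\<lambda>x. std_normal_density x / f i (T i x))"
    by metis
  define T' where "T' i x = std_normal_density x / f i (T i x)" for i x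
  have T': "0 < T' i x" for i x unfolding T'_def by (simp add: normal_density_pos f(3))
  have [measurable]: "f i \<in> borel_measurable borel" for i using f(2) by (rule borel_measurable_continuous_onI)
  have "continuous_on UNIV (T i)" for i by (intro continuous_at_imp_continuous_on ballI DERIV_isCont[OF T(1)])
  then have T_meas [measurable]: "T i \<in> borel_measurable borel" for i by (rule borel_measurable_continuous_onI)
  define \<Theta> where "\<Theta> = weighted_map (\<lambda>i. c $ i) T"
  have [measurable]: "\<Theta> \<in> borel_measurable borel" unfolding \<Theta>_def weighted_map_def[abs_def] by measurable
  have distr_T: "distr gaussian borel (\<lambda>x. T i (x $ i)) = smooth (law i) \<epsilon>" for i
    using distr_distr[of "T i" borel borel "\<lambda>x. x $ i" gaussian] by (simp add: o_def distr_gaussian_nth T(2))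
  \<comment> \<open>Under the Gaussian measure the \<open>T i (x $ i)\<close> are independent with
    the smoothed laws. Since \<open>c\<close> is a unit vector, the Gaussian factors of their
    characteristic functions merge into that of a single smoothing of the sum.\<close>
  have distr_\<Theta>: "distr gaussian borel \<Theta> = smooth sum_law \<epsilon>"
  proof (rule Levy_uniqueness)
    show "real_distribution (distr gaussian borel \<Theta>)" by (rule G.real_distribution_distr) measurable
    show "real_distribution (smooth sum_law \<epsilon>)" ..
    show "char (distr gaussian borel \<Theta>) = char (smooth sum_law \<epsilon>)"
    proof
      fix t
      have "G.indep_vars (\<lambda>_. borel) (\<lambda>i x. T i (x $ i)) UNIV"
        using G.indep_vars_compose2[OF indep_vars_gaussian_nth, of T "\<lambda>_. borel"] by simp
      then have "char (distr gaussian borel \<Theta>) t = (\<Prod>i\<in>UNIV. char (smooth (law i) \<epsilon>) (c $ i * t))"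
        unfolding \<Theta>_def weighted_map_def[abs_def] by (subst G.char_distr_weighted_sum) (auto simp: distr_T)
      also have "\<dots> = (\<Prod>i\<in>UNIV. char (law i) (c $ i * t) * exp (- (\<epsilon> * (c $ i * t))\<^sup>2 / 2))"
        by (intro prod.cong refl) (rule real_distribution.char_smooth[OF real_distribution_law e])
      also have "\<dots> = char sum_law t * exp (- (\<epsilon> * t)\<^sup>2 / 2)"
        unfolding prod.distrib char_sum_law sum_exp_square[OF c] ..
      also have "\<dots> = char (smooth sum_law \<epsilon>) t" by (rule S.char_smooth[OF e, symmetric])
      finally show "char (distr gaussian borel \<Theta>) t = char (smooth sum_law \<epsilon>) t" .
    qed
  qed
  have iq: "integrable (smooth sum_law \<epsilon>) (\<lambda>x. ln (q x))"
  proof (rule Bochner_Integration.integrable_bound)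
    show "integrable (smooth sum_law \<epsilon>) (\<lambda>x. a + b * x\<^sup>2)"
      using S.integrable_square_smooth[OF e sq_sum_law] by simp
    show "AE x in smooth sum_law \<epsilon>. norm (ln (q x)) \<le> norm (a + b * x\<^sup>2)"
      using bound by (intro AE_I2) (smt (verit) real_norm_def)
  qed simp
  \<comment> \<open>Minus the entropy of the standard Gaussian. It occurs once for
    \<open>c \<bullet> x\<close> and once for each coordinate with weight
    \<open>(c $ m)\<^sup>2\<close>; these weights sum to 1, so it cancels.\<close>
  define A where "A = (\<integral>x. ln (std_normal_density x) \<partial>std_normal_distribution)"
  have 1: "integrable gaussian (\<lambda>x. ln (q (\<Theta> x)))" "(\<integral>x. ln (q (\<Theta> x)) \<partial>gaussian) = (\<integral>x. ln (q x) \<partial>smooth sum_law \<epsilon>)"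
    using iq unfolding distr_\<Theta>[symmetric] by (auto simp: integrable_distr_eq integral_distr)
  have 2: "integrable gaussian (\<lambda>x. ln (std_normal_density (c \<bullet> x)))" "(\<integral>x. ln (std_normal_density (c \<bullet> x)) \<partial>gaussian) = A"
    using integrable_std_normal_ln unfolding A_def distr_gaussian_inner[OF c, symmetric]
    by (auto simp: integrable_distr_eq integral_distr)
  have 3: "integrable gaussian (\<lambda>x::real ^ 'n. ln (std_normal_density (x $ i)))"
    "(\<integral>x. ln (std_normal_density (x $ i)) \<partial>(gaussian :: (real ^ 'n) measure)) = A" for i
    using integrable_std_normal_ln unfolding A_def distr_gaussian_nth[of i, symmetric]
    by (auto simp: integrable_distr_eq integral_distr)
  have 4: "integrable gaussian (\<lambda>x. ln (f i (T i (x $ i))))"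
    "(\<integral>x. ln (f i (T i (x $ i))) \<partial>gaussian) = (\<integral>x. ln (f i x) \<partial>smooth (law i) \<epsilon>)" for i
    using f(4)[of i] unfolding distr_T[of i, symmetric] by (auto simp: integrable_distr_eq integral_distr)
  have ln_T': "ln (T' i x) = ln (std_normal_density x) - ln (f i (T i x))" for i x
    unfolding T'_def using f(3)[of i "T i x"] normal_density_pos[of 1 0 x] by (intro ln_divide_pos) auto
  have 5: "integrable gaussian (\<lambda>x::real ^ 'n. ln (T' i (x $ i)))"
    "(\<integral>x. ln (T' i (x $ i)) \<partial>(gaussian :: (real ^ 'n) measure)) = A - (\<integral>x. ln (f i x) \<partial>smooth (law i) \<epsilon>)" for i
    unfolding ln_T' using 3 4 by simp_all
  have "(\<integral>x. ln (q (\<Theta> x)) \<partial>gaussian) +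
    (\<Sum>m\<in>UNIV. (c $ m)\<^sup>2 * (\<integral>x. ln (T' m (x $ m)) \<partial>(gaussian :: (real ^ 'n) measure))) \<le>
    (\<integral>x. ln (std_normal_density (c \<bullet> x)) \<partial>gaussian) + ln C"
    unfolding \<Theta>_def
  proof (rule transport_inequality[OF c, where T=T and T'=T' and q=q and C=C])
    show "(T m has_real_derivative T' m x) (at x)" for m x unfolding T'_def by (rule T(1))
    show "continuous_on UNIV (T' m)" for m unfolding T'_def[abs_def] by (rule T(3))
  qed (use q T' 1(1) 2(1) 5(1) in \<open>auto simp: \<Theta>_def\<close>)
  then have "(\<integral>x. ln (q x) \<partial>smooth sum_law \<epsilon>) + (\<Sum>m\<in>UNIV. (c $ m)\<^sup>2 * (A - (\<integral>x. ln (f m x) \<partial>smooth (law m) \<epsilon>))) \<le> A + ln C"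
    by (simp only: 1(2) 2(2) 5(2))
  moreover have "(\<Sum>m\<in>UNIV. (c $ m)\<^sup>2 * (A - (\<integral>x. ln (f m x) \<partial>smooth (law m) \<epsilon>))) =
    A - (\<Sum>m\<in>UNIV. (c $ m)\<^sup>2 * (\<integral>x. ln (f m x) \<partial>smooth (law m) \<epsilon>))"
    by (simp add: right_diff_distrib sum_subtractf sum_distrib_right[symmetric] sum_square_eq_1[OF c])
  moreover have "(\<Sum>m\<in>UNIV. (c $ m)\<^sup>2 * (\<integral>x. ln (f m x) \<partial>smooth (law m) \<epsilon>)) \<le> mean_ln"
    unfolding mean_ln_def by (intro sum_mono mult_left_mono f(5)) auto
  ultimately show ?thesis by linarith
qed

end

context weighted_sum
begin

text \<open>The bound for the smoothed sum is free of \<epsilon>, so only the left-hand side moves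
  in the limit, and quadratic growth of \<open>ln q\<close> controls it.\<close>

lemma expectation_ln_le:
  assumes q: "continuous_on UNIV q" "\<And>x. 0 < q x" "(\<integral>\<^sup>+x. ennreal (q x) \<partial>lborel) \<le> ennreal C" "0 < C"
    and bound: "\<And>x. \<bar>ln (q x)\<bar> \<le> a + b * x\<^sup>2" and b: "0 \<le> b"
  shows "(\<integral>x. ln (q x) \<partial>sum_law) \<le> mean_ln + ln C"
proof (rule LIMSEQ_le_const2)
  show "(\<lambda>n. \<integral>x. ln (q x) \<partial>smooth sum_law (1 / real (Suc n))) \<longlonglongrightarrow> (\<integral>x. ln (q x) \<partial>sum_law)"
    using q(2) by (intro real_distribution.tendsto_integral_smooth[OF real_distribution_sum_law sq_sum_law _ bound b]
        continuous_on_ln q(1)) (auto simp: less_le)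
  show "\<exists>N. \<forall>n\<ge>N. (\<integral>x. ln (q x) \<partial>smooth sum_law (1 / real (Suc n))) \<le> mean_ln + ln C"
    by (intro exI allI impI expectation_ln_le_smooth[OF _ q bound]) simp
qed

lemma std_normal_continuous: "continuous_on UNIV std_normal_density"
  unfolding std_normal_density_def by (intro continuous_intros) auto

lemma integrable_sum_law_ln_std_normal: "integrable sum_law (\<lambda>x. ln (std_normal_density x))"
proof -
  interpret S: real_distribution sum_law by (rule real_distribution_sum_law)
  show ?thesis using sq_sum_law by (simp add: ln_normal_density)
qed

text \<open>The test density is the Gaussian density times \<open>exp (g x)\<close>, which gives the
  bound the shape of the Donsker-Varadhan formula. Boundedness of \<open>g\<close> leaves the
  quadratic growth to the Gaussian factor.\<close>

lemma expectation_continuous_le: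
  assumes g: "continuous_on UNIV g" "\<And>x. \<bar>g x\<bar> \<le> B"
  shows "(\<integral>x. g x \<partial>sum_law) + (\<integral>x. ln (std_normal_density x) \<partial>sum_law)
    \<le> mean_ln + ln (\<integral>x. exp (g x) \<partial>std_normal_distribution)"
proof -
  interpret S: real_distribution sum_law by (rule real_distribution_sum_law)
  interpret N: real_distribution std_normal_distribution by (rule real_dist_normal_dist)
  have [measurable]: "g \<in> borel_measurable borel" using g(1) by (rule borel_measurable_continuous_onI)
  have ig: "integrable sum_law g"
    using g(2) by (intro S.integrable_const_bound[where B=B]) auto
  have "exp (g x) \<le> exp B" "exp (- B) \<le> exp (g x)" for x
    using g(2)[of x] by auto
  note exp_g = this
  have ie: "integrable std_normal_distribution (\<lambda>x. exp (g x))"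
    using exp_g by (intro N.integrable_const_bound[where B="exp B"]) auto
  have "0 < exp (- B)" by simp
  also have "\<dots> = (\<integral>x. exp (- B) \<partial>std_normal_distribution)" using N.prob_space by simp
  also have "\<dots> \<le> (\<integral>x. exp (g x) \<partial>std_normal_distribution)"
    using ie exp_g by (intro integral_mono) auto
  finally have C: "0 < (\<integral>x. exp (g x) \<partial>std_normal_distribution)" .
  have nn: "(\<integral>\<^sup>+x. ennreal (std_normal_density x * exp (g x)) \<partial>lborel) = ennreal (\<integral>x. exp (g x) \<partial>std_normal_distribution)"
    using ie by (subst nn_integral_eq_integral[symmetric])
      (auto simp: nn_integral_lebesgue_density[OF lebesgue_density_std_normal] ennreal_mult)
  have pos: "0 < std_normal_density x * exp (g x)" for x by (simp add: normal_density_pos)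
  have ln: "ln (std_normal_density x * exp (g x)) = ln (std_normal_density x) + g x" for x
    using normal_density_pos[of 1 0 x] by (subst ln_mult_pos) auto
  have "(\<integral>x. ln (std_normal_density x * exp (g x)) \<partial>sum_law) \<le> mean_ln + ln (\<integral>x. exp (g x) \<partial>std_normal_distribution)"
  proof (rule expectation_ln_le[OF _ pos _ C])
    show "continuous_on UNIV (\<lambda>x. std_normal_density x * exp (g x))"
      by (intro continuous_intros std_normal_continuous g)
    show "(\<integral>\<^sup>+x. ennreal (std_normal_density x * exp (g x)) \<partial>lborel) \<le> ennreal (\<integral>x. exp (g x) \<partial>std_normal_distribution)"
      by (simp only: nn order_refl)
    show "\<bar>ln (std_normal_density x * exp (g x))\<bar> \<le> (\<bar>ln (sqrt (2 * pi))\<bar> + B) + 1 / 2 * x\<^sup>2" for x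
      unfolding ln using g(2)[of x] zero_le_power2[of x] by (simp add: ln_normal_density, linarith)
  qed simp
  then show ?thesis unfolding ln using ig integrable_sum_law_ln_std_normal by simp
qed

text \<open>A measurable function is a limit, almost everywhere, of continuous ones, and truncating
  these at \<open>B\<close> keeps both continuity and the limit. The density \<open>h\<close>
  carries Lebesgue-almost-everywhere convergence over to \<open>sum_law\<close>.\<close>

lemma expectation_bounded_le:
  assumes g [measurable]: "g \<in> borel_measurable borel" and bd: "\<And>x. \<bar>g x\<bar> \<le> B"
    and h: "lebesgue_density sum_law h"
  shows "(\<integral>x. g x \<partial>sum_law) + (\<integral>x. ln (std_normal_density x) \<partial>sum_law)
    \<le> mean_ln + ln (\<integral>x. exp (g x) \<partial>std_normal_distribution)"
proof -
  interpret S: real_distribution sum_law by (rule real_distribution_sum_law)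
  interpret N: real_distribution std_normal_distribution by (rule real_dist_normal_dist)
  have "g \<in> borel_measurable lebesgue" using g by (simp add: measurable_completion)
  then have "g measurable_on UNIV" by (rule lebesgue_measurable_imp_measurable_on) simp
  then obtain A G where A: "negligible A" and G: "\<And>n. continuous_on UNIV (G n)"
    and lim: "\<And>x. x \<notin> A \<Longrightarrow> (\<lambda>n. G n x) \<longlonglongrightarrow> g x"
    unfolding measurable_on_def by auto
  define F where "F n x = max (- B) (min B (G n x))" for n :: nat and x
  have F: "continuous_on UNIV (F n)" for n unfolding F_def by (intro continuous_intros G)
  have [measurable]: "F n \<in> borel_measurable borel" for n using F by (rule borel_measurable_continuous_onI)
  have Fb: "\<bar>F n x\<bar> \<le> B" for n x using bd[of x] unfolding F_def by linarith
  have "AE x in lebesgue. x \<notin> A"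
    using A by (intro AE_not_in) (simp add: negligible_iff_null_sets)
  then have "AE x in lebesgue. (\<lambda>n. F n x) \<longlonglongrightarrow> g x"
  proof eventually_elim
    case (elim x)
    have "(\<lambda>n. max (- B) (min B (G n x))) \<longlonglongrightarrow> max (- B) (min B (g x))"
      by (intro tendsto_intros lim elim)
    moreover have "max (- B) (min B (g x)) = g x" using bd[of x] by linarith
    ultimately show ?case by (simp add: F_def)
  qed
  then have ae: "AE x in lborel. (\<lambda>n. F n x) \<longlonglongrightarrow> g x" by (simp add: AE_completion_iff)
  have 1: "(\<lambda>n. \<integral>x. F n x \<partial>sum_law) \<longlonglongrightarrow> (\<integral>x. g x \<partial>sum_law)"
    using AE_lebesgue_densityI[OF h ae] Fb
    by (intro integral_dominated_convergence[where w="\<lambda>_. B"]) auto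
  have 2: "(\<lambda>n. \<integral>x. exp (F n x) \<partial>std_normal_distribution) \<longlonglongrightarrow> (\<integral>x. exp (g x) \<partial>std_normal_distribution)"
  proof (rule integral_dominated_convergence[where w="\<lambda>_. exp B"])
    show "AE x in std_normal_distribution. (\<lambda>n. exp (F n x)) \<longlonglongrightarrow> exp (g x)"
      using AE_lebesgue_densityI[OF lebesgue_density_std_normal ae] by eventually_elim (rule tendsto_exp)
    show "AE x in std_normal_distribution. norm (exp (F n x)) \<le> exp B" for n
      using Fb[of n] by (intro AE_I2) (auto simp: abs_le_iff)
  qed auto
  have "exp (- B) \<le> exp (g x)" "exp (g x) \<le> exp B" for x using bd[of x] by auto
  note exp_g = this
  have "0 < exp (- B)" by simp
  also have "\<dots> = (\<integral>x. exp (- B) \<partial>std_normal_distribution)" using N.prob_space by simp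
  also have "\<dots> \<le> (\<integral>x. exp (g x) \<partial>std_normal_distribution)"
    using exp_g by (intro integral_mono[OF N.integrable_const N.integrable_const_bound[where B="exp B"]]) auto
  finally have C: "(\<integral>x. exp (g x) \<partial>std_normal_distribution) \<noteq> 0" by simp
  show ?thesis
    by (rule LIMSEQ_le[OF tendsto_add[OF 1 tendsto_const] tendsto_add[OF tendsto_const tendsto_ln[OF 2 C]]])
       (use expectation_continuous_le[OF F Fb] in blast)
qed

text \<open>The optimal \<open>g\<close> is the logarithm of \<open>r\<close>, the density of the
  sum relative to the Gaussian. It is unbounded, hence the truncations; the integral of
  \<open>exp (g n x)\<close> tends to the Gaussian integral of \<open>r\<close>, which is 1, so the
  logarithmic term disappears.\<close>

theorem entropy_sum_ge:
  assumes h: "lebesgue_density sum_law h" and ih: "integrable sum_law (\<lambda>x. ln (h x))"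
  shows "(\<integral>x. ln (h x) \<partial>sum_law) \<le> (\<Sum>i\<in>UNIV. (c $ i)\<^sup>2 * (\<integral>x. ln (p i x) \<partial>law i))"
proof -
  interpret S: real_distribution sum_law by (rule real_distribution_sum_law)
  interpret N: real_distribution std_normal_distribution by (rule real_dist_normal_dist)
  have [measurable]: "h \<in> borel_measurable borel" by (rule lebesgue_densityD(1)[OF h])
  define r where "r x = h x / std_normal_density x" for x
  have [measurable]: "r \<in> borel_measurable borel" unfolding r_def[abs_def] by measurable
  have r0: "0 \<le> r x" for x using lebesgue_densityD(2)[OF h] by (simp add: r_def)
  define g where "g n x = ln (clamp_real n (r x))" for n x
  have [measurable]: "g n \<in> borel_measurable borel" for n unfolding g_def[abs_def] by measurable
  have ln_r: "AE x in sum_law. 0 < r x \<and> ln (r x) = ln (h x) - ln (std_normal_density x)"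
    using AE_lebesgue_density_pos[OF h]
  proof eventually_elim
    case (elim x)
    then show ?case using normal_density_pos[of 1 0 x] unfolding r_def by (simp add: ln_divide_pos)
  qed
  have i_ln: "integrable sum_law (\<lambda>x. ln (h x) - ln (std_normal_density x))"
    using ih integrable_sum_law_ln_std_normal by simp
  have 1: "(\<lambda>n. \<integral>x. g n x \<partial>sum_law) \<longlonglongrightarrow> (\<integral>x. ln (h x) - ln (std_normal_density x) \<partial>sum_law)"
  proof (rule integral_dominated_convergence[where w="\<lambda>x. \<bar>ln (h x) - ln (std_normal_density x)\<bar>"])
    show "AE x in sum_law. (\<lambda>n. g n x) \<longlonglongrightarrow> ln (h x) - ln (std_normal_density x)"
      using ln_r
    proof eventually_elim
      case (elim x)
      then have "(\<lambda>n. g n x) \<longlonglongrightarrow> ln (r x)"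
        unfolding g_def by (intro tendsto_ln clamp_real_tendsto) auto
      then show ?case using elim by simp
    qed
    show "AE x in sum_law. norm (g n x) \<le> \<bar>ln (h x) - ln (std_normal_density x)\<bar>" for n
      using ln_r
    proof eventually_elim
      case (elim x)
      then show ?case unfolding g_def using abs_ln_clamp_real_le[of "r x" n] by simp
    qed
  qed (use i_ln in auto)
  have eq: "exp (g n x) = clamp_real n (r x)" for n x by (simp add: g_def clamp_real_pos)
  have nn_r: "(\<integral>\<^sup>+x. ennreal (r x) \<partial>std_normal_distribution) = 1"
  proof -
    have "std_normal_density x * r x = h x" for x
      unfolding r_def using normal_density_pos[of 1 0 x] by simp
    then have "(\<integral>\<^sup>+x. ennreal (r x) \<partial>std_normal_distribution) = (\<integral>\<^sup>+x. ennreal (h x) * 1 \<partial>lborel)"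
      by (simp add: nn_integral_lebesgue_density[OF lebesgue_density_std_normal] ennreal_mult'[symmetric])
    also have "\<dots> = (\<integral>\<^sup>+x. 1 \<partial>sum_law)"
      by (rule nn_integral_lebesgue_density[OF h, symmetric]) simp
    also have "\<dots> = 1" using S.emeasure_space_1 by simp
    finally show ?thesis .
  qed
  have ir: "integrable std_normal_distribution r"
    using nn_r r0 by (intro integrableI_nonneg) auto
  have "ennreal (\<integral>x. r x \<partial>std_normal_distribution) = 1"
    using ir r0 nn_r by (subst nn_integral_eq_integral[symmetric]) auto
  then have int_r: "(\<integral>x. r x \<partial>std_normal_distribution) = 1" by simp
  have "(\<lambda>n. \<integral>x. exp (g n x) \<partial>std_normal_distribution) \<longlonglongrightarrow> (\<integral>x. r x \<partial>std_normal_distribution)"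
    unfolding eq
  \<comment> \<open>The summand 1 covers the lower truncation, which lifts small values of
    \<open>r\<close>.\<close>
  proof (rule integral_dominated_convergence[where w="\<lambda>x. r x + 1"])
    show "AE x in std_normal_distribution. (\<lambda>n. clamp_real n (r x)) \<longlonglongrightarrow> r x"
      using r0 by (intro AE_I2 clamp_real_tendsto)
    show "AE x in std_normal_distribution. norm (clamp_real n (r x)) \<le> r x + 1" for n
      using clamp_real_le[OF r0] clamp_real_pos by (intro AE_I2) (simp add: abs_of_pos)
  qed (use ir in auto)
  then have 2: "(\<lambda>n. ln (\<integral>x. exp (g n x) \<partial>std_normal_distribution)) \<longlonglongrightarrow> ln 1"
    unfolding int_r by (rule tendsto_ln) simp
  have "(\<integral>x. ln (h x) - ln (std_normal_density x) \<partial>sum_law) + (\<integral>x. ln (std_normal_density x) \<partial>sum_law) \<le> mean_ln + ln 1"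
  proof (rule LIMSEQ_le[OF tendsto_add[OF 1 tendsto_const] tendsto_add[OF tendsto_const 2]])
    show "\<exists>N. \<forall>n\<ge>N. (\<integral>x. g n x \<partial>sum_law) + (\<integral>x. ln (std_normal_density x) \<partial>sum_law) \<le>
      mean_ln + ln (\<integral>x. exp (g n x) \<partial>std_normal_distribution)"
      using expectation_bounded_le[OF _ _ h, of "g n" "ln (real (Suc n))" for n]
      by (auto simp: g_def abs_ln_clamp_real_le_ln simp del: of_nat_Suc)
  qed
  then show ?thesis
    using ih integrable_sum_law_ln_std_normal by (simp add: mean_ln_def)
qed

end

section \<open>Densities and entropies of linear images\<close>

lemma AE_lborel_lebesgue_density:
  assumes "lebesgue_density \<mu> p" "\<And>x. 0 < p x" "AE x in \<mu>. Q x"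
  shows "AE x in lborel. Q x"
proof -
  note [measurable] = lebesgue_densityD(1)[OF assms(1)]
  show ?thesis
    using assms(2,3) by (subst (asm) lebesgue_densityD(3)[OF assms(1)], subst (asm) AE_density) auto
qed

text \<open>Radon-Nikodym; finiteness of \<mu> gives a real-valued version of the
  derivative.\<close>

lemma lebesgue_densityI_AE:
  fixes \<mu> :: "'b::euclidean_space measure"
  assumes "prob_space \<mu>" and sets: "sets \<mu> = sets borel"
    and ac: "\<And>N. N \<in> sets borel \<Longrightarrow> AE x in lborel. x \<notin> N \<Longrightarrow> AE x in \<mu>. x \<notin> N"
  shows "\<exists>p. lebesgue_density \<mu> p"
proof -
  interpret prob_space \<mu> by fact
  have ac': "absolutely_continuous lborel \<mu>"
    unfolding absolutely_continuous_def
  proof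
    fix N :: "'b set" assume N: "N \<in> null_sets lborel"
    then have "AE x in \<mu>. x \<notin> N" by (intro ac AE_not_in) auto
    then show "N \<in> null_sets \<mu>" using N by (subst AE_iff_null_sets) (auto simp: sets)
  qed
  have sets': "sets \<mu> = sets lborel" by (simp add: sets)
  obtain D where D: "D \<in> borel_measurable lborel" "AE x in lborel. RN_deriv lborel \<mu> x = ennreal (D x)" "\<And>x. 0 \<le> D x"
    using sigma_finite_measure.real_RN_deriv[OF sigma_finite_lborel finite_measure_axioms ac' sets'] by blast
  have "\<mu> = density lborel (RN_deriv lborel \<mu>)"
    using sigma_finite_measure.density_RN_deriv[OF sigma_finite_lborel ac'] sets by simp
  also have "\<dots> = density lborel (\<lambda>x. ennreal (D x))"
    using D by (intro density_cong) auto
  finally have "\<mu> = density lborel (\<lambda>x. ennreal (D x))" .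
  then have "lebesgue_density \<mu> D" unfolding lebesgue_density_def using D prob_space_axioms by auto
  then show ?thesis by blast
qed

text \<open>
  The relative entropy with respect to the Gaussian measure does not increase under \<open>L\<close>. Together with
  the lower bound from \<open>- ln r \<le> 1 / r\<close>, this makes the logarithm of the image density integrable.
\<close>

lemma finite_entropy_image:
  fixes P :: "(real ^ 'n) measure" and L :: "real ^ 'n \<Rightarrow> 'c::euclidean_space"
  assumes P: "lebesgue_density P F" "integrable P (\<lambda>x. ln (F x))"
    and lnR: "integrable P (\<lambda>x. ln (std_gauss x))"
    and L [measurable]: "L \<in> borel \<rightarrow>\<^sub>M borel"
    and R': "lebesgue_density (distr gaussian borel L) R'" "\<And>x. 0 < R' x"
    and lnR': "integrable P (\<lambda>x. ln (R' (L x)))"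
  shows "\<exists>p. lebesgue_density (distr P borel L) p \<and> integrable (distr P borel L) (\<lambda>x. ln (p x))"
proof -
  define Q where "Q = distr P borel L"
  interpret P: prob_space P by (rule lebesgue_densityD(4)[OF P(1)])
  have [measurable_cong]: "sets P = sets borel" by (rule lebesgue_densityD(5)[OF P(1)])
  have [measurable_cong]: "sets (gaussian :: (real ^ 'n) measure) = sets borel"
    by (rule lebesgue_densityD(5)[OF lebesgue_density_gaussian])
  have [measurable_cong]: "sets Q = sets borel" by (simp add: Q_def)
  interpret Q: prob_space Q unfolding Q_def by (rule P.prob_space_distr) measurable
  interpret G': prob_space "distr gaussian borel L" by (rule lebesgue_densityD(4)[OF R'(1)])
  note [measurable] = lebesgue_densityD(1)[OF P(1)] lebesgue_densityD(1)[OF R'(1)]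
    lebesgue_densityD(1)[OF lebesgue_density_gaussian]
  \<comment> \<open>The Gaussian measure has the null sets of Lebesgue measure, and its image under
    \<open>L\<close> has a density. So preimages of Lebesgue null sets under \<open>L\<close> are
    Lebesgue null, hence null for \<open>P\<close>.\<close>
  have "\<exists>p. lebesgue_density Q p"
  proof (rule lebesgue_densityI_AE)
    fix N :: "'c set" assume [measurable]: "N \<in> sets borel" and "AE x in lborel. x \<notin> N"
    then have "AE x in distr gaussian borel L. x \<notin> N" by (intro AE_lebesgue_densityI[OF R'(1)])
    then have "AE x in gaussian. L x \<notin> N" by (subst (asm) AE_distr_iff) auto
    then have "AE x in lborel. L x \<notin> N"
      by (rule AE_lborel_lebesgue_density[OF lebesgue_density_gaussian std_gauss_pos])
    then have "AE x in P. L x \<notin> N" by (rule AE_lebesgue_densityI[OF P(1)])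
    then show "AE x in Q. x \<notin> N" unfolding Q_def by (subst AE_distr_iff) auto
  qed (auto simp: Q_def Q.prob_space_axioms[unfolded Q_def])
  then obtain p where p: "lebesgue_density Q p" by blast
  note [measurable] = lebesgue_densityD(1)[OF p]
  define r where "r x = p x / R' x" for x
  have r0: "0 \<le> r x" for x using lebesgue_densityD(2)[OF p] R'(2)[of x] by (simp add: r_def less_imp_le)
  have [measurable]: "r \<in> borel_measurable borel" unfolding r_def[abs_def] by measurable
  have rpos: "AE x in Q. 0 < r x \<and> ln (r x) = ln (p x) - ln (R' x)"
    using AE_lebesgue_density_pos[OF p] by eventually_elim (simp add: r_def R'(2) ln_divide_pos)
  define g where "g n x = ln (clamp_real n (r x))" for n x
  have [measurable]: "g n \<in> borel_measurable borel" for n unfolding g_def[abs_def] by measurable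
  have gb: "\<bar>g n x\<bar> \<le> ln (real (Suc n))" for n x unfolding g_def by (rule abs_ln_clamp_real_le_ln)
  have ig: "integrable Q (g n)" for n using gb by (intro Q.integrable_const_bound) auto
  have nn_r: "(\<integral>\<^sup>+x. ennreal (r x) \<partial>distr gaussian borel L) \<le> 1"
  proof -
    have "ennreal (R' x) * ennreal (r x) = ennreal (p x)" for x
      using R'(2)[of x] r0[of x] by (subst ennreal_mult[symmetric]) (auto simp: r_def)
    then have "(\<integral>\<^sup>+x. ennreal (r x) \<partial>distr gaussian borel L) = (\<integral>\<^sup>+x. ennreal (p x) * 1 \<partial>lborel)"
      by (simp add: nn_integral_lebesgue_density[OF R'(1)])
    also have "\<dots> = (\<integral>\<^sup>+x. 1 \<partial>Q)" by (rule nn_integral_lebesgue_density[OF p, symmetric]) simp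
    finally show ?thesis using Q.emeasure_space_1 by simp
  qed
  \<comment> \<open>The entropy of \<open>P\<close> relative to the Gaussian, plus
    \<open>ln 2\<close>. The 2 bounds the integral of the truncated ratio, which is at most
    \<open>r x + 1\<close>.\<close>
  define B where "B = ln 2 + P.expectation (\<lambda>y. ln (F y)) - P.expectation (\<lambda>y. ln (std_gauss y))"
  have g_le: "Q.expectation (g n) \<le> B" for n
  proof -
    define k where "k y = g n (L y) + ln (std_gauss y) - ln (F y)" for y
    have igL: "integrable P (\<lambda>y. g n (L y))"
      using ig[of n] unfolding Q_def by (simp add: integrable_distr_eq)
    have "AE y in P. exp (k y) = clamp_real n (r (L y)) * std_gauss y / F y"
      using AE_lebesgue_density_pos[OF P(1)]
      by eventually_elim (simp add: k_def exp_diff exp_add g_def clamp_real_pos std_gauss_pos)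
    then have "(\<integral>\<^sup>+y. ennreal (exp (k y)) \<partial>P) = (\<integral>\<^sup>+y. ennreal (clamp_real n (r (L y)) * std_gauss y / F y) \<partial>P)"
      by (intro nn_integral_cong_AE) auto
    also have "\<dots> \<le> (\<integral>\<^sup>+y. ennreal (clamp_real n (r (L y)) * std_gauss y) \<partial>lborel)"
      by (rule nn_integral_lebesgue_density_divide_le[OF P(1)])
         (auto intro!: less_imp_le mult_pos_pos clamp_real_pos std_gauss_pos)
    also have "\<dots> = (\<integral>\<^sup>+y. ennreal (std_gauss y) * ennreal (clamp_real n (r (L y))) \<partial>lborel)"
      by (intro nn_integral_cong)
         (simp add: ennreal_mult mult.commute less_imp_le[OF clamp_real_pos] less_imp_le[OF std_gauss_pos])
    also have "\<dots> = (\<integral>\<^sup>+y. ennreal (clamp_real n (r (L y))) \<partial>gaussian)"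
      by (rule nn_integral_lebesgue_density[OF lebesgue_density_gaussian, symmetric]) measurable
    also have "\<dots> = (\<integral>\<^sup>+x. ennreal (clamp_real n (r x)) \<partial>distr gaussian borel L)"
      by (subst nn_integral_distr) auto
    also have "\<dots> \<le> (\<integral>\<^sup>+x. ennreal (r x) + 1 \<partial>distr gaussian borel L)"
    proof (rule nn_integral_mono)
      fix x
      have "ennreal (clamp_real n (r x)) \<le> ennreal (r x + 1)" by (intro ennreal_leI clamp_real_le r0)
      then show "ennreal (clamp_real n (r x)) \<le> ennreal (r x) + 1" using r0[of x] by (simp add: ennreal_plus)
    qed
    also have "\<dots> = (\<integral>\<^sup>+x. ennreal (r x) \<partial>distr gaussian borel L) + 1"
      using G'.emeasure_space_1 by (subst nn_integral_add) auto
    also have "\<dots> \<le> 1 + 1" using nn_r by (rule add_right_mono)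
    also have "\<dots> = ennreal 2" by simp
    finally have "P.expectation k \<le> ln 2"
      using igL P lnR unfolding k_def[abs_def] by (intro P.expectation_le_ln_nn_integral_exp) auto
    moreover have "Q.expectation (g n) = P.expectation (\<lambda>y. g n (L y))"
      unfolding Q_def by (subst integral_distr) auto
    ultimately show ?thesis using igL P lnR unfolding k_def B_def by simp
  qed
  have nn_inv: "(\<integral>\<^sup>+x. ennreal (1 / r x) \<partial>Q) \<le> 1"
  proof -
    have "(\<integral>\<^sup>+x. ennreal (1 / r x) \<partial>Q) = (\<integral>\<^sup>+x. ennreal (R' x / p x) \<partial>Q)" by (simp add: r_def)
    also have "\<dots> \<le> (\<integral>\<^sup>+x. ennreal (R' x) * 1 \<partial>lborel)"
      using nn_integral_lebesgue_density_divide_le[OF p, of R'] R'(2) by (auto simp: less_imp_le)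
    also have "\<dots> = (\<integral>\<^sup>+x. 1 \<partial>distr gaussian borel L)"
      by (rule nn_integral_lebesgue_density[OF R'(1), symmetric]) simp
    also have "\<dots> = 1" using G'.emeasure_space_1 by simp
    finally show ?thesis .
  qed
  \<comment> \<open>The absolute value is \<open>g n\<close> plus twice its negative part; the first
    has expectation at most \<open>B\<close>, the second at most 1 because \<open>1 / r\<close> has
    integral at most 1.\<close>
  have abs_g: "(\<integral>\<^sup>+x. ennreal \<bar>g n x\<bar> \<partial>Q) \<le> ennreal (B + 2)" for n
  proof -
    have im: "integrable Q (\<lambda>x. max 0 (- g n x))" using ig by simp
    have "ennreal (Q.expectation (\<lambda>x. max 0 (- g n x))) = (\<integral>\<^sup>+x. ennreal (max 0 (- g n x)) \<partial>Q)"
      using im by (intro nn_integral_eq_integral[symmetric]) auto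
    also have "\<dots> \<le> (\<integral>\<^sup>+x. ennreal (1 / r x) \<partial>Q)"
    proof (rule nn_integral_mono_AE, use rpos in eventually_elim)
      case (elim x)
      have "- g n x \<le> 1 / r x"
      proof (cases "1 \<le> r x")
        case True
        have "1 / real (Suc n) \<le> 1" "1 \<le> real (Suc n)" by simp_all
        then have "1 \<le> clamp_real n (r x)" using True unfolding clamp_real_def by linarith
        then have "0 \<le> g n x" unfolding g_def by simp
        then show ?thesis using elim by (simp add: order_trans[of _ 0])
      next
        case False
        have "- g n x \<le> \<bar>ln (r x)\<bar>" using abs_ln_clamp_real_le[of "r x" n] elim unfolding g_def by linarith
        also have "\<dots> = ln (1 / r x)"
        proof -
          have r: "0 < r x" "r x < 1" using elim False by auto
          then have "ln (r x) < 0" by (rule ln_less_zero)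
          then show ?thesis using r by (simp add: ln_div)
        qed
        also have "\<dots> \<le> 1 / r x - 1" using elim by (intro ln_le_minus_one) auto
        finally show ?thesis by simp
      qed
      then show ?case using elim by (intro ennreal_leI) auto
    qed
    also have "\<dots> \<le> ennreal 1" using nn_inv by simp
    finally have neg: "Q.expectation (\<lambda>x. max 0 (- g n x)) \<le> 1" by (subst (asm) ennreal_le_iff) auto
    have "(\<integral>\<^sup>+x. ennreal \<bar>g n x\<bar> \<partial>Q) = ennreal (Q.expectation (\<lambda>x. \<bar>g n x\<bar>))"
      using ig by (intro nn_integral_eq_integral) auto
    also have "Q.expectation (\<lambda>x. \<bar>g n x\<bar>) = Q.expectation (\<lambda>x. g n x + 2 * max 0 (- g n x))"
      by (intro Bochner_Integration.integral_cong) auto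
    also have "\<dots> = Q.expectation (g n) + 2 * Q.expectation (\<lambda>x. max 0 (- g n x))"
      using ig im by simp
    also have "\<dots> \<le> B + 2" using g_le[of n] neg by simp
    finally show ?thesis by (simp add: ennreal_leI)
  qed
  \<comment> \<open>Fatou's lemma turns the bound uniform in \<open>n\<close> into integrability of
    the untruncated logarithm.\<close>
  have "(\<integral>\<^sup>+x. ennreal \<bar>ln (r x)\<bar> \<partial>Q) = (\<integral>\<^sup>+x. liminf (\<lambda>n. ennreal \<bar>g n x\<bar>) \<partial>Q)"
  proof (rule nn_integral_cong_AE, use rpos in eventually_elim)
    case (elim x)
    have "(\<lambda>n. ennreal \<bar>g n x\<bar>) \<longlonglongrightarrow> ennreal \<bar>ln (r x)\<bar>"
      unfolding g_def using elim r0[of x] by (intro tendsto_ennrealI tendsto_rabs tendsto_ln clamp_real_tendsto) auto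
    then show ?case by (intro lim_imp_Liminf[symmetric]) auto
  qed
  also have "\<dots> \<le> liminf (\<lambda>n. \<integral>\<^sup>+x. ennreal \<bar>g n x\<bar> \<partial>Q)"
    by (rule nn_integral_liminf) measurable
  also have "\<dots> \<le> ennreal (B + 2)"
    using abs_g by (intro Liminf_le) (auto intro: always_eventually)
  finally have "(\<integral>\<^sup>+x. ennreal (norm (ln (r x))) \<partial>Q) < \<infinity>"
    by (auto simp: less_top[symmetric] top_unique)
  then have "integrable Q (\<lambda>x. ln (r x))" by (intro integrableI_bounded) auto
  moreover have "integrable Q (\<lambda>x. ln (R' x))" unfolding Q_def using lnR' by (subst integrable_distr_eq) auto
  ultimately have "integrable Q (\<lambda>x. ln (r x) + ln (R' x))" by (rule Bochner_Integration.integrable_add)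
  then have "integrable Q (\<lambda>x. ln (p x))"
  proof (rule integrable_cong_AE_imp)
    show "AE x in Q. ln (r x) + ln (R' x) = ln (p x)" using rpos by eventually_elim simp
  qed measurable
  then show ?thesis using p unfolding Q_def by blast
qed

section \<open>Finite entropy of coordinates and blocks\<close>

lemma ln_std_gauss: "ln (std_gauss (x :: real ^ 'n)) = ln ((1 / sqrt (2 * pi)) ^ CARD('n)) - (x \<bullet> x) / 2"
  unfolding std_gauss_eq by (subst ln_mult_pos) auto

context
  fixes P :: "(real ^ 'n) measure" and F :: "real ^ 'n \<Rightarrow> real"
  assumes P: "lebesgue_density P F" "integrable P (\<lambda>x. ln (F x))" "\<And>i. integrable P (\<lambda>x. (x $ i)\<^sup>2)"
begin

interpretation prob_space P by (rule lebesgue_densityD(4)[OF P(1)])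

lemma integrable_ln_std_gauss: "integrable P (\<lambda>x. ln (std_gauss x))"
  using P(3) unfolding ln_std_gauss inner_vec_def by (simp add: power2_eq_square)

lemma finite_entropy_nth:
  "\<exists>p. lebesgue_density (distr P borel (\<lambda>x. x $ i)) p \<and> integrable (distr P borel (\<lambda>x. x $ i)) (\<lambda>x. ln (p x))"
proof (rule finite_entropy_image[OF P(1,2) integrable_ln_std_gauss, where R'=std_normal_density])
  show "lebesgue_density (distr gaussian borel (\<lambda>x. x $ i)) std_normal_density"
    unfolding distr_gaussian_nth by (rule lebesgue_density_std_normal)
qed (use P(3) in \<open>auto simp: normal_density_pos ln_normal_density\<close>)

end

lemma finite_entropy_block:
  fixes P :: "(real ^ ('m::finite \<times> 'd::finite)) measure"
  assumes P: "lebesgue_density P F" "integrable P (\<lambda>x. ln (F x))" "\<And>i. integrable P (\<lambda>x. (x $ i)\<^sup>2)"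
  shows "\<exists>p. lebesgue_density (distr P borel (block m)) p \<and> integrable (distr P borel (block m)) (\<lambda>x. ln (p x))"
proof (rule finite_entropy_image[OF P(1,2) integrable_ln_std_gauss[OF P], where R'=std_gauss])
  interpret prob_space P by (rule lebesgue_densityD(4)[OF P(1)])
  show "lebesgue_density (distr gaussian borel (block m)) std_gauss"
    unfolding distr_gaussian_block by (rule lebesgue_density_gaussian)
  show "integrable P (\<lambda>x. ln (std_gauss (block m x)))"
    using P(3) unfolding ln_std_gauss inner_vec_def by (simp add: power2_eq_square)
qed (auto simp: std_gauss_pos)

section \<open>Densities under orthogonal matrices\<close>

lemma borel_measurable_matrix_vector_mult [measurable]: "(*v) (V :: real ^ 'n ^ 'm) \<in> borel_measurable borel"
  by (intro borel_measurable_continuous_onI linear_continuous_on matrix_vector_mul_bounded_linear)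

text \<open>
  The library's change of variables for linear maps of \<open>real ^ 'n\<close> needs a well-ordered index type, which
  \<open>'m \<times> 'd\<close> is not. Instead, translation invariance and Fubini's theorem with the rotation invariant
  weight \<open>std_gauss\<close> give the claim as in the uniqueness proof for Haar measure.
\<close>

lemma distr_lborel_orthogonal_matrix:
  fixes V :: "real ^ 'n ^ 'n"
  assumes V: "orthogonal_matrix V"
  shows "distr lborel borel ((*v) V) = lborel"
proof (rule measure_eqI)

  note [measurable] = lebesgue_densityD(1)[OF lebesgue_density_gaussian]
  have V': "transpose V ** V = mat 1" "V ** transpose V = mat 1"
    using V by (auto simp: orthogonal_matrix_def)
  have norm: "(V *v x) \<bullet> (V *v x) = x \<bullet> x" for x
    using V by (metis orthogonal_transformation_def orthogonal_transformation_matrix matrix_of_matrix_vector_mul matrix_vector_mul_linear)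
  have shift: "(\<integral>\<^sup>+x. ennreal (std_gauss (x + a)) \<partial>lborel) = 1" for a :: "real ^ 'n"
  proof -
    interpret prob_space "gaussian :: (real ^ 'n) measure" by (rule lebesgue_densityD(4)[OF lebesgue_density_gaussian])
    have "(\<integral>\<^sup>+x. ennreal (std_gauss (x + a)) \<partial>lborel) = (\<integral>\<^sup>+x. ennreal (std_gauss (x :: real ^ 'n)) * 1 \<partial>lborel)"
      by (subst nn_integral_lborel_shift) auto
    also have "\<dots> = (\<integral>\<^sup>+x. 1 \<partial>(gaussian :: (real ^ 'n) measure))"
      by (rule nn_integral_lebesgue_density[OF lebesgue_density_gaussian, symmetric]) simp
    finally show ?thesis by (simp add: emeasure_space_1)
  qed
  have rot: "std_gauss (y - V *v x) = std_gauss (x + - (transpose V *v y))" for x y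
  proof -
    have "V *v (transpose V *v y - x) = y - V *v x"
      by (simp only: matrix_vector_mult_diff_distrib matrix_vector_mul_assoc V' matrix_vector_mul_lid)
    then have "y - V *v x = V *v (- (x + - (transpose V *v y)))"
      by (simp del: transpose_matrix_vector)
    then show ?thesis using norm[of "- (x + - (transpose V *v y))"] by (simp only: std_gauss_eq inner_minus_left inner_minus_right minus_minus)
  qed
  fix A assume "A \<in> sets (distr lborel borel ((*v) V))"
  then have [measurable]: "A \<in> sets borel" by simp
  have "emeasure (distr lborel borel ((*v) V)) A = (\<integral>\<^sup>+x. indicator A (V *v x) \<partial>lborel)"
    by (simp add: nn_integral_distr flip: nn_integral_indicator)
  also have "\<dots> = (\<integral>\<^sup>+x. indicator A (V *v x) * (\<integral>\<^sup>+y. ennreal (std_gauss (y + 0 :: real ^ 'n)) \<partial>lborel) \<partial>lborel)"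
    by (simp only: shift mult_1_right)
  also have "\<dots> = (\<integral>\<^sup>+x. \<integral>\<^sup>+y. indicator A (V *v x) * ennreal (std_gauss (y :: real ^ 'n)) \<partial>lborel \<partial>lborel)"
    by (subst nn_integral_cmult) auto
  also have "\<dots> = (\<integral>\<^sup>+y. \<integral>\<^sup>+x. indicator A (V *v x) * ennreal (std_gauss (y :: real ^ 'n)) \<partial>lborel \<partial>lborel)"
    by (rule lborel_pair.Fubini'[symmetric]) simp
  \<comment> \<open>Shifting \<open>x\<close> by \<open>transpose V *v y\<close> turns
    \<open>V *v x\<close> into \<open>V *v x + y\<close>. A later shift of \<open>y\<close> by
    \<open>- (V *v x)\<close> leaves \<open>y\<close> alone in the indicator and moves
    \<open>x\<close> into the Gaussian weight, where it integrates to 1.\<close>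
  also have "\<dots> = (\<integral>\<^sup>+y. \<integral>\<^sup>+x. indicator A (V *v (x + transpose V *v y)) * ennreal (std_gauss (y :: real ^ 'n)) \<partial>lborel \<partial>lborel)"
    by (intro nn_integral_cong nn_integral_lborel_shift[symmetric]) measurable
  also have "\<dots> = (\<integral>\<^sup>+y. \<integral>\<^sup>+x. indicator A (V *v x + y) * ennreal (std_gauss y) \<partial>lborel \<partial>lborel)"
    by (simp only: matrix_vector_right_distrib matrix_vector_mul_assoc V' matrix_vector_mul_lid)
  also have "\<dots> = (\<integral>\<^sup>+x. \<integral>\<^sup>+y. indicator A (V *v x + y) * ennreal (std_gauss y) \<partial>lborel \<partial>lborel)"
    by (rule lborel_pair.Fubini') simp
  also have "\<dots> = (\<integral>\<^sup>+x. \<integral>\<^sup>+y. indicator A (V *v x + (y + - (V *v x))) * ennreal (std_gauss (y + - (V *v x))) \<partial>lborel \<partial>lborel)"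
    by (intro nn_integral_cong nn_integral_lborel_shift[symmetric]) measurable
  also have "\<dots> = (\<integral>\<^sup>+x. \<integral>\<^sup>+y. indicator A y * ennreal (std_gauss (x + - (transpose V *v y))) \<partial>lborel \<partial>lborel)"
    unfolding rot[symmetric] by simp
  also have "\<dots> = (\<integral>\<^sup>+y. \<integral>\<^sup>+x. indicator A y * ennreal (std_gauss (x + - (transpose V *v y))) \<partial>lborel \<partial>lborel)"
    by (rule lborel_pair.Fubini'[symmetric]) measurable
  also have "\<dots> = (\<integral>\<^sup>+y. indicator A y * (\<integral>\<^sup>+x. ennreal (std_gauss (x + - (transpose V *v y))) \<partial>lborel) \<partial>lborel)"
    by (intro nn_integral_cong nn_integral_cmult) measurable
  also have "\<dots> = emeasure lborel A" by (simp only: shift mult_1_right) simp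
  finally show "emeasure (distr lborel borel ((*v) V)) A = emeasure lborel A" .
qed simp

lemma lebesgue_density_orthogonal_matrix:
  fixes V :: "real ^ 'n ^ 'n"
  assumes P: "lebesgue_density P F" and V: "orthogonal_matrix V"
  shows "lebesgue_density (distr P borel ((*v) V)) (\<lambda>x. F (transpose V *v x))"
proof -
  interpret prob_space P by (rule lebesgue_densityD(4)[OF P])
  have [measurable_cong]: "sets P = sets borel" by (rule lebesgue_densityD(5)[OF P])
  note [measurable] = lebesgue_densityD(1)[OF P]
  have V': "transpose V ** V = mat 1" using V by (auto simp: orthogonal_matrix_def)
  have "distr P borel ((*v) V) = distr (density lborel (\<lambda>x. ennreal (F (transpose V *v (V *v x))))) borel ((*v) V)"
    by (subst lebesgue_densityD(3)[OF P]) (simp add: matrix_vector_mul_assoc V' del: transpose_matrix_vector)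
  also have "\<dots> = density (distr lborel borel ((*v) V)) (\<lambda>x. ennreal (F (transpose V *v x)))"
    by (rule density_distr[symmetric]) (auto simp del: transpose_matrix_vector)
  finally have "distr P borel ((*v) V) = density lborel (\<lambda>x. ennreal (F (transpose V *v x)))"
    by (simp only: distr_lborel_orthogonal_matrix[OF V])
  moreover have "prob_space (distr P borel ((*v) V))" by (rule prob_space_distr) measurable
  ultimately show ?thesis
    using lebesgue_densityD(2)[OF P] by (auto simp: lebesgue_density_def simp del: transpose_matrix_vector)
qed

section \<open>Independent subspace analysis\<close>

lemma diff_entropy_eq:
  assumes "prob_space M" and [measurable]: "X \<in> M \<rightarrow>\<^sub>M borel" and p: "lebesgue_density (distr M borel X) p"
  shows "diff_entropy M X = - (\<integral>x. ln (p x) \<partial>distr M borel X)"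
proof -
  interpret prob_space M by fact
  interpret information_space M "exp 1" by unfold_locales simp
  note [measurable] = lebesgue_densityD(1)[OF p]
  have "distr M lborel X = distr M borel X" by (intro distr_cong) auto
  then have "distributed M lborel X (\<lambda>x. ennreal (p x))"
    unfolding distributed_def using lebesgue_densityD(3)[OF p] by auto
  then have "diff_entropy M X = - (\<integral>x. p x * log (exp 1) (p x) \<partial>lborel)"
    unfolding diff_entropy_def using lebesgue_densityD(2)[OF p] by (intro entropy_distr) auto
  also have "(\<integral>x. p x * log (exp 1) (p x) \<partial>lborel) = (\<integral>x. ln (p x) \<partial>distr M borel X)"
    using lebesgue_densityD(2)[OF p]
    by (subst lebesgue_densityD(3)[OF p], subst integral_density) (auto simp: log_def)
  finally show ?thesis .
qed

lemma diff_entropy_cong: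
  assumes "\<And>\<omega>. \<omega> \<in> space M \<Longrightarrow> X \<omega> = Y \<omega>" and "prob_space M"
  shows "diff_entropy M X = diff_entropy M Y"
proof -
  have "distr M lborel X = distr M lborel Y" using assms(1) by (intro distr_cong) auto
  then show ?thesis using assms(2) by (simp add: diff_entropy_def prob_space.entropy_def)
qed

lemma lebesgue_density_of_finite_entropy:
  assumes "prob_space M" and fe: "information_space.finite_entropy M (exp 1) lborel X g"
  shows "X \<in> M \<rightarrow>\<^sub>M borel" "lebesgue_density (distr M borel X) g" "integrable (distr M borel X) (\<lambda>x. ln (g x))"
proof -
  interpret prob_space M by fact
  interpret information_space M "exp 1" by unfold_locales simp
  have d: "distributed M lborel X (\<lambda>x. ennreal (g x))" and i: "integrable lborel (\<lambda>x. g x * log (exp 1) (g x))"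
    and nn: "\<And>x. 0 \<le> g x" using fe unfolding finite_entropy_def by auto
  have [measurable]: "g \<in> borel_measurable borel" using finite_entropy_measurable[OF fe] by simp
  show X [measurable]: "X \<in> M \<rightarrow>\<^sub>M borel" using distributed_measurable[OF d] by simp
  have "distr M borel X = distr M lborel X" by (intro distr_cong) auto
  then have eq: "distr M borel X = density lborel (\<lambda>x. ennreal (g x))"
    using distributed_distr_eq_density[OF d] by simp
  then show "lebesgue_density (distr M borel X) g"
    unfolding lebesgue_density_def using nn prob_space_distr[OF X] by auto
  show "integrable (distr M borel X) (\<lambda>x. ln (g x))"
    unfolding eq using i nn by (subst integrable_density) (auto simp: log_def)
qed

text \<open>Of whiteness only the square integrability of the coordinates is kept here; the
  covariance itself enters through \<open>white_image_orthogonal\<close>.\<close>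

locale isa_sources = prob_space M for M :: "'a measure" +
  fixes s :: "'m::finite \<Rightarrow> 'a \<Rightarrow> real ^ 'd::finite" and f :: "'m \<Rightarrow> real ^ 'd \<Rightarrow> real"
  assumes indep: "indep_vars (\<lambda>_. borel) s UNIV"
    and dens: "\<And>m. lebesgue_density (distr M borel (s m)) (f m)"
    and ent: "\<And>m. integrable (distr M borel (s m)) (\<lambda>x. ln (f m x))"
    and sq: "\<And>m i. integrable M (\<lambda>\<omega>. (s m \<omega> $ i)\<^sup>2)"
begin

lemma s_measurable [measurable]: "random_variable borel (s m)"
  using indep unfolding indep_vars_def by auto

definition S :: "'a \<Rightarrow> real ^ ('m \<times> 'd)" where "S \<omega> = stack (\<lambda>m. s m \<omega>)"

lemma S_nth: "S \<omega> $ (m, i) = s m \<omega> $ i" by (simp add: S_def)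

lemma S_measurable [measurable]: "random_variable borel S"
  unfolding S_def[abs_def] by (rule measurable_compose[OF _ block.J]) (intro measurable_abs_UNIV s_measurable)

definition F :: "real ^ ('m \<times> 'd) \<Rightarrow> real" where "F x = (\<Prod>m\<in>UNIV. f m (block m x))"

lemma law_S: "lebesgue_density (distr M borel S) F"
  unfolding S_def[abs_def] F_def[abs_def]
  using block.lebesgue_density_product[of "\<lambda>m. distr M borel (s m)" f] dens
    block.distr_J_indep_vars[OF prob_space_axioms indep] by simp

lemma block_S [simp]: "block m (S \<omega>) = s m \<omega>"
  by (simp add: S_def)

lemma ln_F: "AE \<omega> in M. ln (F (S \<omega>)) = (\<Sum>m\<in>UNIV. ln (f m (s m \<omega>)))"
proof -
  have "AE \<omega> in M. 0 < f m (s m \<omega>)" for m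
    using AE_lebesgue_density_pos[OF dens[of m]] lebesgue_densityD(1)[OF dens[of m]]
    by (subst (asm) AE_distr_iff) auto
  then have "AE \<omega> in M. \<forall>m\<in>UNIV. 0 < f m (s m \<omega>)" by (intro AE_finite_allI) auto
  then show ?thesis
  proof eventually_elim
    case (elim \<omega>)
    then have "f m (s m \<omega>) \<noteq> 0" for m by (metis UNIV_I less_irrefl)
    then show ?case by (simp add: F_def ln_prod)
  qed
qed

lemma f_measurable [measurable]: "f m \<in> borel_measurable borel" by (rule lebesgue_densityD(1)[OF dens])
lemma F_measurable [measurable]: "F \<in> borel_measurable borel" by (rule lebesgue_densityD(1)[OF law_S])

lemma integrable_ln_f: "integrable M (\<lambda>\<omega>. ln (f m (s m \<omega>)))"
  using ent[of m] by (subst (asm) integrable_distr_eq) auto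

lemma diff_entropy_s: "diff_entropy M (s m) = - (\<integral>\<omega>. ln (f m (s m \<omega>)) \<partial>M)"
  by (subst diff_entropy_eq[OF prob_space_axioms _ dens]) (auto simp: integral_distr)

lemma integrable_ln_F: "integrable M (\<lambda>\<omega>. ln (F (S \<omega>)))"
proof (rule integrable_cong_AE_imp)
  show "integrable M (\<lambda>\<omega>. \<Sum>m\<in>UNIV. ln (f m (s m \<omega>)))"
    by (intro Bochner_Integration.integrable_sum integrable_ln_f)
  show "AE \<omega> in M. (\<Sum>m\<in>UNIV. ln (f m (s m \<omega>))) = ln (F (S \<omega>))" using ln_F by eventually_elim simp
qed measurable

lemma integral_ln_F: "(\<integral>\<omega>. ln (F (S \<omega>)) \<partial>M) = - (\<Sum>m\<in>UNIV. diff_entropy M (s m))"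
proof -
  have "(\<integral>\<omega>. ln (F (S \<omega>)) \<partial>M) = (\<integral>\<omega>. (\<Sum>m\<in>UNIV. ln (f m (s m \<omega>))) \<partial>M)"
    by (intro integral_cong_AE ln_F) auto
  then show ?thesis by (simp add: integrable_ln_f diff_entropy_s sum_negf)
qed

lemma sq_inner: "integrable M (\<lambda>\<omega>. (w \<bullet> S \<omega>)\<^sup>2)"
proof (rule Bochner_Integration.integrable_bound)
  show "integrable M (\<lambda>\<omega>. (w \<bullet> w) * (\<Sum>k\<in>UNIV. (S \<omega> $ k)\<^sup>2))"
    using sq by (intro integrable_mult_right Bochner_Integration.integrable_sum) (auto simp: S_def)
  have "(w \<bullet> x)\<^sup>2 \<le> (w \<bullet> w) * (\<Sum>k\<in>UNIV. (x $ k)\<^sup>2)" for x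
    using Cauchy_Schwarz_ineq[of w x] by (simp add: inner_vec_def[of x x] power2_eq_square)
  then show "AE \<omega> in M. norm ((w \<bullet> S \<omega>)\<^sup>2) \<le> norm ((w \<bullet> w) * (\<Sum>k\<in>UNIV. (S \<omega> $ k)\<^sup>2))"
    unfolding real_norm_def abs_power2 by (intro AE_I2 order_trans[OF _ abs_ge_self])
qed simp

context
  fixes V :: "real ^ ('m \<times> 'd) ^ ('m \<times> 'd)"
  assumes V: "orthogonal_matrix V"
begin

abbreviation Y :: "'a \<Rightarrow> real ^ ('m \<times> 'd)" where "Y \<omega> \<equiv> V *v S \<omega>"

lemma Y_measurable [measurable]: "random_variable borel Y"
  by measurable

lemma distr_Y: "distr (distr M borel S) borel ((*v) V) = distr M borel Y"
  by (subst distr_distr) (auto simp: o_def)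

lemma law_Y: "lebesgue_density (distr M borel Y) (\<lambda>x. F (transpose V *v x))"
  using lebesgue_density_orthogonal_matrix[OF law_S V] by (simp only: distr_Y)

lemma transpose_V: "transpose V *v (V *v x) = x"
  using V by (simp add: matrix_vector_mul_assoc orthogonal_matrix_def del: transpose_matrix_vector)

lemma entropy_Y:
  "integrable (distr M borel Y) (\<lambda>x. ln (F (transpose V *v x)))"
  "(\<integral>x. ln (F (transpose V *v x)) \<partial>distr M borel Y) = - (\<Sum>m\<in>UNIV. diff_entropy M (s m))"
  using lebesgue_densityD(1)[OF law_Y] integrable_ln_F
  by (auto simp: integrable_distr_eq integral_distr transpose_V integral_ln_F simp del: transpose_matrix_vector)

lemma sq_Y: "integrable (distr M borel Y) (\<lambda>x. (x $ k)\<^sup>2)"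
  using sq_inner[of "V $ k"] by (subst integrable_distr_eq) (auto simp: matrix_vector_mul_component)

lemma finite_entropy_Y_nth:
  "\<exists>p. lebesgue_density (distr M borel (\<lambda>\<omega>. Y \<omega> $ k)) p \<and>
    integrable (distr M borel (\<lambda>\<omega>. Y \<omega> $ k)) (\<lambda>x. ln (p x))"
  using finite_entropy_nth[OF law_Y entropy_Y(1) sq_Y, of k] by (simp add: distr_distr o_def)

text \<open>Gibbs' inequality for the joint density of \<open>Y\<close> against the product
  \<open>q\<close> of its block marginals, in other words nonnegativity of the mutual information of
  the blocks.\<close>

lemma sum_diff_entropy_le:
  "(\<Sum>m\<in>UNIV. diff_entropy M (s m)) \<le> (\<Sum>m\<in>UNIV. diff_entropy M (\<lambda>\<omega>. block m (Y \<omega>)))"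
proof -
  have "\<exists>p. lebesgue_density (distr M borel (\<lambda>\<omega>. block m (Y \<omega>))) p \<and>
    integrable (distr M borel (\<lambda>\<omega>. block m (Y \<omega>))) (\<lambda>x. ln (p x))" for m
    using finite_entropy_block[OF law_Y entropy_Y(1) sq_Y, of m] by (simp add: distr_distr o_def)
  then obtain p where p: "\<And>m. lebesgue_density (distr M borel (\<lambda>\<omega>. block m (Y \<omega>))) (p m)"
    and ip: "\<And>m. integrable (distr M borel (\<lambda>\<omega>. block m (Y \<omega>))) (\<lambda>x. ln (p m x))"
    by metis
  have [measurable]: "p m \<in> borel_measurable borel" for m by (rule lebesgue_densityD(1)[OF p])
  define q where "q x = (\<Prod>m\<in>UNIV. p m (block m x))" for x
  have q: "lebesgue_density (distr (PiM UNIV (\<lambda>m. distr M borel (\<lambda>\<omega>. block m (Y \<omega>)))) borel stack) q"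
    unfolding q_def[abs_def] by (rule block.lebesgue_density_product[OF p])
  note [measurable] = lebesgue_densityD(1)[OF q]
  interpret Q: prob_space "distr (PiM UNIV (\<lambda>m. distr M borel (\<lambda>\<omega>. block m (Y \<omega>)))) borel stack"
    by (rule lebesgue_densityD(4)[OF q])
  have nn: "(\<integral>\<^sup>+x. ennreal (q x) \<partial>lborel) \<le> ennreal 1"
    using nn_integral_lebesgue_density[OF q, of "\<lambda>_. 1"] Q.emeasure_space_1 by simp
  have ip': "integrable M (\<lambda>\<omega>. ln (p m (block m (Y \<omega>))))" for m
    using ip[of m] by (subst (asm) integrable_distr_eq) auto
  have "AE \<omega> in M. 0 < p m (block m (Y \<omega>))" for m
    using AE_lebesgue_density_pos[OF p[of m]] by (subst (asm) AE_distr_iff) auto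
  then have "AE \<omega> in M. \<forall>m\<in>UNIV. 0 < p m (block m (Y \<omega>))" by (intro AE_finite_allI) auto
  then have ae: "AE \<omega> in M. 0 < q (Y \<omega>) \<and> ln (q (Y \<omega>)) = (\<Sum>m\<in>UNIV. ln (p m (block m (Y \<omega>))))"
  proof eventually_elim
    case (elim \<omega>)
    then have "p m (block m (Y \<omega>)) \<noteq> 0" for m by (metis UNIV_I less_irrefl)
    with elim show ?case unfolding q_def by (auto simp: ln_prod intro!: prod_pos)
  qed
  have iq: "integrable M (\<lambda>\<omega>. ln (q (Y \<omega>)))"
  proof (rule integrable_cong_AE_imp)
    show "integrable M (\<lambda>\<omega>. \<Sum>m\<in>UNIV. ln (p m (block m (Y \<omega>))))"
      by (intro Bochner_Integration.integrable_sum ip')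
    show "AE \<omega> in M. (\<Sum>m\<in>UNIV. ln (p m (block m (Y \<omega>)))) = ln (q (Y \<omega>))" using ae by eventually_elim simp
  qed measurable
  have "(\<integral>x. ln (q x) \<partial>distr M borel Y) \<le> (\<integral>x. ln (F (transpose V *v x)) \<partial>distr M borel Y) + ln 1"
  proof (rule Gibbs_inequality_ln[OF law_Y entropy_Y(1) _ _ _ nn])
    have "AE \<omega> in M. 0 < q (Y \<omega>)" using ae by eventually_elim simp
    then show "AE x in distr M borel Y. 0 < q x" by (subst AE_distr_iff) auto
    show "integrable (distr M borel Y) (\<lambda>x. ln (q x))" using iq by (simp add: integrable_distr_eq)
  qed (use lebesgue_densityD(2)[OF q] in auto)
  also have "(\<integral>x. ln (q x) \<partial>distr M borel Y) = (\<integral>\<omega>. ln (q (Y \<omega>)) \<partial>M)"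
    by (rule integral_distr) measurable
  also have "\<dots> = (\<integral>\<omega>. (\<Sum>m\<in>UNIV. ln (p m (block m (Y \<omega>)))) \<partial>M)"
  proof (rule integral_cong_AE)
    show "AE \<omega> in M. ln (q (Y \<omega>)) = (\<Sum>m\<in>UNIV. ln (p m (block m (Y \<omega>))))" using ae by eventually_elim simp
  qed measurable
  also have "\<dots> = (\<Sum>m\<in>UNIV. \<integral>\<omega>. ln (p m (block m (Y \<omega>))) \<partial>M)"
    using ip' by simp
  also have "\<dots> = - (\<Sum>m\<in>UNIV. diff_entropy M (\<lambda>\<omega>. block m (Y \<omega>)))"
    by (simp add: diff_entropy_eq[OF prob_space_axioms _ p] integral_distr sum_negf)
  finally show ?thesis by (simp add: entropy_Y(2) del: transpose_matrix_vector)
qed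

end

text \<open>A unit vector can be completed to an orthogonal matrix, which makes
  \<open>w \<bullet> S \<omega>\<close> a coordinate of an orthogonal image of
  \<open>S\<close>.\<close>

lemma finite_entropy_inner:
  fixes w :: "real ^ ('m \<times> 'd)"
  assumes "norm w = 1"
  shows "\<exists>p. lebesgue_density (distr M borel (\<lambda>\<omega>. w \<bullet> S \<omega>)) p \<and>
    integrable (distr M borel (\<lambda>\<omega>. w \<bullet> S \<omega>)) (\<lambda>x. ln (p x))"
proof -
  obtain k :: "'m \<times> 'd" where True by simp
  obtain B where B: "orthogonal_matrix B" "B *v axis k 1 = w"
    using orthogonal_matrix_exists_basis[OF assms, of k] by blast
  have "orthogonal_matrix (transpose B)" using B by (simp add: orthogonal_matrix_transpose)
  moreover have "(transpose B *v x) $ k = w \<bullet> x" for x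
  proof -
    have "(transpose B *v x) $ k = (transpose B *v x) \<bullet> axis k 1" by (simp add: inner_axis del: transpose_matrix_vector)
    also have "\<dots> = x \<bullet> (B *v axis k 1)" by (simp add: dot_lmul_matrix)
    finally show ?thesis using B by (simp add: inner_commute)
  qed
  ultimately show ?thesis using finite_entropy_Y_nth[of "transpose B" k] by simp
qed

end

section \<open>Entropy of unit combinations of all source coordinates\<close>

lemma inner_eq_sum_block: "x \<bullet> y = (\<Sum>m\<in>UNIV. block m x \<bullet> block m y)"
  by (simp add: inner_vec_def sum.cartesian_product case_prod_beta flip: UNIV_Times_UNIV)

context isa_sources
begin

lemma diff_entropy_inner_ge:
  fixes v :: "real ^ ('m \<times> 'd)"
  assumes v: "norm v = 1"
    and H: "\<And>m w. norm w = 1 \<Longrightarrow> (\<Sum>i\<in>UNIV. (w $ i)\<^sup>2 * diff_entropy M (\<lambda>\<omega>. s m \<omega> $ i))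
      \<le> diff_entropy M (\<lambda>\<omega>. \<Sum>i\<in>UNIV. w $ i * s m \<omega> $ i)"
  shows "(\<Sum>m\<in>UNIV. \<Sum>i\<in>UNIV. (v $ (m, i))\<^sup>2 * diff_entropy M (\<lambda>\<omega>. s m \<omega> $ i)) \<le> diff_entropy M (\<lambda>\<omega>. v \<bullet> S \<omega>)"
proof -
  define c :: "real ^ 'm" where "c = (\<chi> m. norm (block m v))"
  \<comment> \<open>A zero block has no direction. Any unit vector may stand in, because its weight
    \<open>c $ m\<close> is 0.\<close>
  define e :: "real ^ 'd" where "e = axis undefined 1"
  define w where "w m = (if block m v = 0 then e else block m v /\<^sub>R norm (block m v))" for m
  have w: "norm (w m) = 1" and cw: "block m v = c $ m *\<^sub>R w m" for m
    by (auto simp: w_def e_def c_def norm_axis_1)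
  have "c \<bullet> c = v \<bullet> v"
    unfolding inner_eq_sum_block[of v v] inner_vec_def[of c c] by (simp add: c_def dot_square_norm power2_eq_square)
  then have c: "norm c = 1" using v by (simp add: norm_eq_sqrt_inner)
  define X where "X m \<omega> = w m \<bullet> s m \<omega>" for m \<omega>
  \<comment> \<open>The unit vector \<open>w m\<close> placed in block \<open>m\<close> of the full
    space: this makes \<open>X m\<close> a unit combination of the coordinates of \<open>S\<close>,
    to which the finiteness results apply.\<close>
  define w' where "w' m = stack (\<lambda>m'. if m' = m then w m else 0)" for m :: 'm
  have w'_inner: "w' m \<bullet> y = w m \<bullet> block m y" for m y
    unfolding inner_eq_sum_block by (simp add: w'_def if_distrib[of "\<lambda>x. x \<bullet> _"] cong: if_cong)
  have "block m (w' m) = w m" for m by (simp add: w'_def)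
  then have w': "norm (w' m) = 1" for m using w[of m] by (simp add: norm_eq_sqrt_inner w'_inner)
  have X_S: "X m \<omega> = w' m \<bullet> S \<omega>" for m \<omega> by (simp add: X_def w'_inner)
  have "\<exists>p. lebesgue_density (distr M borel (X m)) p \<and> integrable (distr M borel (X m)) (\<lambda>x. ln (p x))" for m
    unfolding X_S[abs_def] by (rule finite_entropy_inner[OF w'])
  then obtain p where p: "\<And>m. lebesgue_density (distr M borel (X m)) (p m)"
    "\<And>m. integrable (distr M borel (X m)) (\<lambda>x. ln (p m x))" by metis
  interpret W: weighted_sum M X p c
  proof
    show "indep_vars (\<lambda>_. borel) X UNIV"
      unfolding X_def[abs_def] using indep_vars_compose2[OF indep, of "\<lambda>m x. w m \<bullet> x" "\<lambda>_. borel"] by simp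
    show "integrable M (\<lambda>\<omega>. (X m \<omega>)\<^sup>2)" for m unfolding X_S by (rule sq_inner)
  qed (use p c in auto)
  have sum: "(\<Sum>m\<in>UNIV. c $ m * X m \<omega>) = v \<bullet> S \<omega>" for \<omega>
    unfolding inner_eq_sum_block X_def by (simp add: cw)
  obtain h where h: "lebesgue_density (distr M borel (\<lambda>\<omega>. v \<bullet> S \<omega>)) h"
    "integrable (distr M borel (\<lambda>\<omega>. v \<bullet> S \<omega>)) (\<lambda>x. ln (h x))"
    using finite_entropy_inner[OF v] by blast
  have "(\<Sum>m\<in>UNIV. \<Sum>i\<in>UNIV. (v $ (m, i))\<^sup>2 * diff_entropy M (\<lambda>\<omega>. s m \<omega> $ i)) =
    (\<Sum>m\<in>UNIV. (c $ m)\<^sup>2 * (\<Sum>i\<in>UNIV. (w m $ i)\<^sup>2 * diff_entropy M (\<lambda>\<omega>. s m \<omega> $ i)))"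
  proof (rule sum.cong[OF refl])
    fix m
    have "v $ (m, i) = c $ m * w m $ i" for i using arg_cong[OF cw[of m], of "\<lambda>x. x $ i"] by simp
    then show "(\<Sum>i\<in>UNIV. (v $ (m, i))\<^sup>2 * diff_entropy M (\<lambda>\<omega>. s m \<omega> $ i)) =
      (c $ m)\<^sup>2 * (\<Sum>i\<in>UNIV. (w m $ i)\<^sup>2 * diff_entropy M (\<lambda>\<omega>. s m \<omega> $ i))"
      by (simp add: power_mult_distrib sum_distrib_left mult.assoc)
  qed
  also have "\<dots> \<le> (\<Sum>m\<in>UNIV. (c $ m)\<^sup>2 * diff_entropy M (X m))"
    unfolding X_def[abs_def] inner_vec_def inner_real_def by (intro sum_mono mult_left_mono H w) auto
  also have "\<dots> = - (\<Sum>m\<in>UNIV. (c $ m)\<^sup>2 * (\<integral>x. ln (p m x) \<partial>distr M borel (X m)))"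
    by (simp add: diff_entropy_eq[OF prob_space_axioms _ p(1)] sum_negf)
  also have "\<dots> \<le> - (\<integral>x. ln (h x) \<partial>distr M borel (\<lambda>\<omega>. v \<bullet> S \<omega>))"
    using W.entropy_sum_ge[of h] h by (simp add: W.sum_law_def sum)
  also have "\<dots> = diff_entropy M (\<lambda>\<omega>. v \<bullet> S \<omega>)"
    by (rule diff_entropy_eq[OF prob_space_axioms _ h(1), symmetric]) measurable
  finally show ?thesis .
qed

lemma sum_diff_entropy_nth_le:
  assumes V: "orthogonal_matrix V"
    and H: "\<And>m w. norm w = 1 \<Longrightarrow> (\<Sum>i\<in>UNIV. (w $ i)\<^sup>2 * diff_entropy M (\<lambda>\<omega>. s m \<omega> $ i))
      \<le> diff_entropy M (\<lambda>\<omega>. \<Sum>i\<in>UNIV. w $ i * s m \<omega> $ i)"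
  shows "(\<Sum>m\<in>UNIV. \<Sum>i\<in>UNIV. diff_entropy M (\<lambda>\<omega>. s m \<omega> $ i))
    \<le> (\<Sum>m\<in>UNIV. \<Sum>i\<in>UNIV. diff_entropy M (\<lambda>\<omega>. (V *v S \<omega>) $ (m, i)))"
proof -
  define \<eta> where "\<eta> k = diff_entropy M (\<lambda>\<omega>. s (fst k) \<omega> $ snd k)" for k
  have col: "(\<Sum>k\<in>UNIV. (V $ k $ l)\<^sup>2) = 1" for l
  proof -
    have "(transpose V ** V) $ l $ l = 1" using V by (simp add: orthogonal_matrix_def mat_def)
    then show ?thesis by (simp add: matrix_matrix_mult_def transpose_def power2_eq_square)
  qed
  have row: "norm (V $ k) = 1" for k
    using V unfolding orthogonal_matrix_orthonormal_rows by (cases k) (simp add: row_def vec_nth_inverse)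
  have "(\<Sum>m\<in>UNIV. \<Sum>i\<in>UNIV. diff_entropy M (\<lambda>\<omega>. s m \<omega> $ i)) = (\<Sum>l\<in>UNIV. \<eta> l)"
    by (simp add: \<eta>_def sum.cartesian_product case_prod_beta flip: UNIV_Times_UNIV)
  also have "\<dots> = (\<Sum>l\<in>UNIV. \<Sum>k\<in>UNIV. (V $ k $ l)\<^sup>2 * \<eta> l)"
    by (simp add: sum_distrib_right[symmetric] col)
  also have "\<dots> = (\<Sum>k\<in>UNIV. \<Sum>l\<in>UNIV. (V $ k $ l)\<^sup>2 * \<eta> l)"
    by (rule sum.swap)
  also have "\<dots> \<le> (\<Sum>k\<in>UNIV. diff_entropy M (\<lambda>\<omega>. (V *v S \<omega>) $ k))"
  proof (rule sum_mono)
    fix k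
    have "(\<Sum>l\<in>UNIV. (V $ k $ l)\<^sup>2 * \<eta> l) =
      (\<Sum>m\<in>UNIV. \<Sum>i\<in>UNIV. (V $ k $ (m, i))\<^sup>2 * diff_entropy M (\<lambda>\<omega>. s m \<omega> $ i))"
      by (simp add: \<eta>_def sum.cartesian_product case_prod_beta flip: UNIV_Times_UNIV)
    also have "\<dots> \<le> diff_entropy M (\<lambda>\<omega>. V $ k \<bullet> S \<omega>)" by (rule diff_entropy_inner_ge[OF row H])
    finally show "(\<Sum>l\<in>UNIV. (V $ k $ l)\<^sup>2 * \<eta> l) \<le> diff_entropy M (\<lambda>\<omega>. (V *v S \<omega>) $ k)"
      by (simp only: matrix_vector_mul_component)
  qed
  also have "\<dots> = (\<Sum>m\<in>UNIV. \<Sum>i\<in>UNIV. diff_entropy M (\<lambda>\<omega>. (V *v S \<omega>) $ (m, i)))"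
    by (simp add: sum.cartesian_product case_prod_beta flip: UNIV_Times_UNIV)
  finally show ?thesis .
qed

end

section \<open>Whiteness and the mixing matrix\<close>

lemma white_nth:
  fixes X :: "'a \<Rightarrow> real ^ 'b"
  assumes "white M X"
  shows "has_bochner_integral M (\<lambda>\<omega>. X \<omega> $ i * X \<omega> $ j) (if i = j then 1 else 0)"
proof -
  have "bounded_linear (\<lambda>B :: real ^ 'b ^ 'b. B $ i $ j)"
    by (rule bounded_linear_compose[OF bounded_linear_vec_nth bounded_linear_vec_nth])
  from has_bochner_integral_bounded_linear[OF this assms[unfolded white_def, THEN conjunct2]]
  have "has_bochner_integral M (\<lambda>\<omega>. (\<chi> i j. X \<omega> $ i * X \<omega> $ j) $ i $ j) ((mat 1 :: real ^ 'b ^ 'b) $ i $ j)" .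
  then show ?thesis by (simp add: mat_def)
qed

text \<open>The second moment matrix of \<open>A *v X \<omega>\<close> is
  \<open>A ** transpose A\<close> when that of \<open>X\<close> is the identity, and whiteness of
  \<open>Z\<close> makes it the identity too.\<close>

lemma white_image_orthogonal:
  fixes A :: "real ^ 'n ^ 'n"
  assumes X: "white M X" and Z: "white M Z" and A: "\<And>\<omega>. \<omega> \<in> space M \<Longrightarrow> Z \<omega> = A *v X \<omega>"
  shows "orthogonal_matrix A"
proof -
  have "(A ** transpose A) $ i $ j = (mat 1 :: real ^ 'n ^ 'n) $ i $ j" for i j
  proof -
    have "has_bochner_integral M (\<lambda>\<omega>. \<Sum>k\<in>UNIV. \<Sum>l\<in>UNIV. (A $ i $ k * A $ j $ l) * (X \<omega> $ k * X \<omega> $ l))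
      (\<Sum>k\<in>UNIV. \<Sum>l\<in>UNIV. (A $ i $ k * A $ j $ l) * (if k = l then 1 else 0))"
      by (rule has_bochner_integral_sum, rule has_bochner_integral_sum, rule has_bochner_integral_mult_right, rule white_nth[OF X])
    also have "(\<Sum>k\<in>UNIV. \<Sum>l\<in>UNIV. (A $ i $ k * A $ j $ l) * (if k = l then 1 else 0)) = (A ** transpose A) $ i $ j"
    proof -
      have "(\<Sum>l\<in>UNIV. (A $ i $ k * A $ j $ l) * (if k = l then 1 else 0)) = A $ i $ k * A $ j $ k" for k
        by (subst sum.remove[of _ k]) (auto intro!: sum.neutral)
      then show ?thesis by (simp add: matrix_matrix_mult_def transpose_def)
    qed
    also have "has_bochner_integral M (\<lambda>\<omega>. \<Sum>k\<in>UNIV. \<Sum>l\<in>UNIV. (A $ i $ k * A $ j $ l) * (X \<omega> $ k * X \<omega> $ l)) =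
      has_bochner_integral M (\<lambda>\<omega>. Z \<omega> $ i * Z \<omega> $ j)"
    proof (intro ext has_bochner_integral_cong refl)
      fix \<omega> assume "\<omega> \<in> space M"
      then show "(\<Sum>k\<in>UNIV. \<Sum>l\<in>UNIV. (A $ i $ k * A $ j $ l) * (X \<omega> $ k * X \<omega> $ l)) = Z \<omega> $ i * Z \<omega> $ j"
        by (simp only: A matrix_vector_mult_def vec_lambda_beta sum_product) (simp only: mult_ac)
    qed
    finally have "has_bochner_integral M (\<lambda>\<omega>. Z \<omega> $ i * Z \<omega> $ j) ((A ** transpose A) $ i $ j)" .
    from has_bochner_integral_eq[OF this white_nth[OF Z, of i j]] show ?thesis by (simp only: mat_def vec_lambda_beta)
  qed
  then have AA: "A ** transpose A = mat 1" by (simp add: vec_eq_iff)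
  then have "transpose A ** A = mat 1" by (rule matrix_left_right_inverse[THEN iffD1])
  then show ?thesis using AA by (simp add: orthogonal_matrix_def)
qed

theorem theorem1:
  fixes M :: "'a measure"
    and s :: "'m::finite \<Rightarrow> 'a \<Rightarrow> real ^ 'd"
    and f :: "'m \<Rightarrow> real ^ 'd \<Rightarrow> real"
    and A :: "real ^ ('m \<times> 'd) ^ ('m \<times> 'd)"
    and z :: "'a \<Rightarrow> real ^ ('m \<times> 'd)"
  assumes "prob_space M"
    and "prob_space.indep_vars M (\<lambda>_. borel) s UNIV"
    and "\<And>m. information_space.finite_entropy M (exp 1) lborel (s m) (f m)"
    and "invertible A"
    and "\<And>\<omega>. \<omega> \<in> space M \<Longrightarrow> z \<omega> = A *v stack (\<lambda>m. s m \<omega>)"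
    and "white M (\<lambda>\<omega>. stack (\<lambda>m. s m \<omega>))"
    and "white M z"
    and "\<And>m w. w \<in> sphere 0 1 \<Longrightarrow>
           diff_entropy M (\<lambda>\<omega>. \<Sum>i\<in>UNIV. w $ i * s m \<omega> $ i)
             \<ge> (\<Sum>i\<in>UNIV. (w $ i)\<^sup>2 * diff_entropy M (\<lambda>\<omega>. s m \<omega> $ i))"
    and "\<exists>W. is_arg_min (J_ICA M z) orthogonal_matrix W"
  shows "\<exists>W_ICA P. is_arg_min (J_ICA M z) orthogonal_matrix W_ICA \<and>
           permutation_matrix P \<and>
           is_arg_min (J_ISA M z) orthogonal_matrix (P ** W_ICA)"
proof -
  interpret isa_sources M s f
  proof (intro isa_sources.intro isa_sources_axioms.intro)
    show "integrable M (\<lambda>\<omega>. (s m \<omega> $ i)\<^sup>2)" for m i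
      using white_nth[OF assms(6), of "(m, i)" "(m, i)"] by (auto simp: power2_eq_square has_bochner_integral_iff)
  qed (use assms(1,2) lebesgue_density_of_finite_entropy[OF assms(1,3)] in auto)
  have z: "z \<omega> = A *v S \<omega>" if "\<omega> \<in> space M" for \<omega> using assms(5)[OF that] by (simp add: S_def)
  have A: "orthogonal_matrix A" by (rule white_image_orthogonal[OF assms(6,7,5)])
  have H: "(\<Sum>i\<in>UNIV. (w $ i)\<^sup>2 * diff_entropy M (\<lambda>\<omega>. s m \<omega> $ i))
      \<le> diff_entropy M (\<lambda>\<omega>. \<Sum>i\<in>UNIV. w $ i * s m \<omega> $ i)" if "norm w = 1" for m w
    using assms(8)[of w m] that by simp
  have ISA: "J_ISA M z W = (\<Sum>m\<in>UNIV. diff_entropy M (\<lambda>\<omega>. block m ((W ** A) *v S \<omega>)))" for W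
    unfolding J_ISA_def
    by (intro sum.cong refl diff_entropy_cong[OF _ assms(1)]) (simp add: z matrix_vector_mul_assoc)
  have ICA: "J_ICA M z W = (\<Sum>m\<in>UNIV. \<Sum>i\<in>UNIV. diff_entropy M (\<lambda>\<omega>. ((W ** A) *v S \<omega>) $ (m, i)))" for W
    unfolding J_ICA_def
    by (intro sum.cong refl diff_entropy_cong[OF _ assms(1)]) (simp add: z matrix_vector_mul_assoc)
  \<comment> \<open>For orthogonal \<open>W\<close> the product \<open>W ** A\<close> is orthogonal,
    so both lower bounds apply to it. At \<open>W0\<close> it is the identity, and the costs are
    exactly the entropy sums of the sources that form those bounds.\<close>
  define W0 where "W0 = transpose A"
  have W0: "orthogonal_matrix W0" "W0 ** A = mat 1"
    using A by (simp_all add: W0_def orthogonal_matrix_transpose orthogonal_matrix_def)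
  have "J_ISA M z W0 \<le> J_ISA M z W" "J_ICA M z W0 \<le> J_ICA M z W" if "orthogonal_matrix W" for W
    using sum_diff_entropy_le[OF orthogonal_matrix_mul[OF that A]]
      sum_diff_entropy_nth_le[OF orthogonal_matrix_mul[OF that A] H]
    unfolding ISA ICA by (simp_all add: W0 S_nth)
  then have "is_arg_min (J_ICA M z) orthogonal_matrix W0" "is_arg_min (J_ISA M z) orthogonal_matrix (mat 1 ** W0)"
    using W0(1) by (auto simp: is_arg_min_linorder)
  moreover have "permutation_matrix (mat 1 :: real ^ ('m \<times> 'd) ^ ('m \<times> 'd))"
    unfolding permutation_matrix_def
    by (intro exI[of _ id] conjI permutes_id) (auto simp: mat_def vec_eq_iff)
  ultimately show ?thesis by blast
qed

end
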